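(* In IITT, if $\Gamma\vdash t=t':T$ then $\Gamma\vdash t\Longleftrightarrow_{\mathsf{tm}}t':T$.
   Context: Irrelevant Intensional Type Theory (IITT) is defined as follows. Sorts are $\mathsf{Set}_k$ ($k\in\mathbb{N}$), with $\mathsf{Axiom}=\{(\mathsf{Set}_i,\mathsf{Set}_{i+1})\}$ and $\mathsf{Rule}=\{(\mathsf{Set}_i,\mathsf{Set}_j,\mathsf{Set}_{\max(i,j)})\}$. Annotations $\star\in\{:,\div\}$ (relevant, irrelevant). Expressions: $t,u,T,U ::= s \mid (x\star U)\to^{s,s'}T \mid x \mid \lambda x\star U.\,t \mid t\star u$ (relevant/irrelevant dependent function types annotated with domain sort $s$ and codomain sort $s'$; abstractions; relevant application $t\,u$ and irrelevant application $t\div u$), modulo $\alpha$-equivalence; $[u/x]t$ is substitution. Contexts $\Gamma ::= ()\mid\Gamma.x\star T$. Resurrection $\Gamma^\oplus$ turns every $x\div T$ into $x:T$. Abbreviations: $\Gamma\vdash t\div T$ means $\Gamma^\oplus\vdash t:T$; $\Gamma\vdash t=t'\div T$ means $\Gamma\vdash t\div T$ and $\Gamma\vdash t'\div T$; $\Gamma\vdash T$ means $\Gamma\vdash T:s$ for some sort $s$; $\Gamma\vdash T=T'$ means $\Gamma\vdash T=T':s$ for some $s$. Rules: $\vdash()$; from $\vdash\Gamma$, $\Gamma\vdash T$ infer $\vdash\Gamma.x\star T$; from $\vdash\Gamma$, $(s,s')\in\mathsf{Axiom}$ infer $\Gamma\vdash s:s'$; from $\Gamma\vdash U:s_1$, $\Gamma.x\star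 U\vdash T:s_2$, $(s_1,s_2,s_3)\in\mathsf{Rule}$ infer $\Gamma\vdash(x\star U)\to^{s_1,s_2}T:s_3$; from $\vdash\Gamma$, $(x:U)\in\Gamma$ infer $\Gamma\vdash x:U$; from $\Gamma.x\star U\vdash t:T$, $\Gamma\vdash(x\star U)\to^{s,s'}T$ infer $\Gamma\vdash\lambda x\star U.t:(x\star U)\to^{s,s'}T$; from $\Gamma\vdash t:(x\star U)\to^{s,s'}T$, $\Gamma\vdash u\star U$ infer $\Gamma\vdash t\star u:[u/x]T$; from $\Gamma\vdash t:T$, $\Gamma\vdash T=T'$ infer $\Gamma\vdash t:T'$; $\beta$: from $\Gamma.x\star U\vdash t:T$, $\Gamma\vdash u\star U$ infer $\Gamma\vdash(\lambda x\star U.t)\star u=[u/x]t:[u/x]T$; $\eta$: from $\Gamma\vdash t:(x\star U)\to^{s,s'}T$ infer $\Gamma\vdash t=\lambda x\star U.(t\star x):(x\star U)\to^{s,s'}T$; reflexivity, symmetry, transitivity; congruence for function types (from $\Gamma\vdash U=U':s_1$, $\Gamma.x\star U\vdash T=T':s_2$, $(s_1,s_2,s_3)\in\mathsf{Rule}$), for abstractions (from $\Gamma\vdash U=U':s_1$, $\Gamma.x\star U\vdash T:s_2$, $\Gamma.x\star U\vdash t=t':T$ infer $\Gamma\vdash\lambda x\star U.t=\lambda x\star U'.t':(x\star U)\to^{s_1,s_2}T$), for application (from $\Gamma\vdash t=t':(x\star U)\to^{s,s'}T$ and $\Gamma\vdash u=u'\star U$ infer $\Gamma\vdash t\star u=t'\star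 u':[u/x]T$); conversion: from $\Gamma\vdash t=t':T$, $\Gamma\vdash T=T'$ infer $\Gamma\vdash t=t':T'$. Weak head normal forms $a,A ::= s\mid(x\star U)\to^{s,s'}T\mid\lambda x\star U.t\mid n$; neutrals $n,N ::= x\mid n\star u$. Weak head evaluation: $a\searrow a$ for whnf $a$; if $t\searrow f$ and $f\,@^\star u\searrow a$ then $t\star u\searrow a$; if $[u/x]t\searrow a$ then $(\lambda x\star U.t)\,@^\star u\searrow a$; $n\,@^\star u\searrow n\star u$. Algorithmic equality (mutually inductive; long arrows on whnf types): Type equality: $\Delta\vdash T\Longleftrightarrow_{\mathsf{ty}}T'$ if $T\searrow A$, $T'\searrow A'$, $\Delta\vdash A\longleftrightarrow_{\mathsf{ty}}A'$; $\Delta\vdash s\longleftrightarrow_{\mathsf{ty}}s$; $\Delta\vdash(x\star U)\to^{s,s'}T\longleftrightarrow_{\mathsf{ty}}(x\star U')\to^{s,s'}T'$ if $\Delta\vdash U\Longleftrightarrow_{\mathsf{ty}}U'$ and $\Delta.x\star U\vdash T\Longleftrightarrow_{\mathsf{ty}}T'$; $\Delta\vdash N\longleftrightarrow_{\mathsf{ty}}N'$ for neutrals if $\Delta\vdash N\Longleftrightarrow_{\mathsf{ne}}N':T$ for some $T$. Structural equality (type is output): $\Delta\vdash x\Longleftrightarrow_{\mathsf{ne}}x:T$ if $(x:T)\in\Delta$; $\Delta\vdash n\,u\Longleftrightarrow_{\mathsf{ne}}n'\,u':[u/x]T$ if $\Delta\vdash n\longleftrightarrow_{\mathsf{ne}}n':(x:U)\to^{s,s'}T$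 and $\Delta\vdash u\Longleftrightarrow_{\mathsf{tm}}u':U$; $\Delta\vdash n\div u\Longleftrightarrow_{\mathsf{ne}}n'\div u':[u/x]T$ if $\Delta\vdash n\longleftrightarrow_{\mathsf{ne}}n':(x\div U)\to^{s,s'}T$; $\Delta\vdash n\longleftrightarrow_{\mathsf{ne}}n':A$ if $\Delta\vdash n\Longleftrightarrow_{\mathsf{ne}}n':T$ and $T\searrow A$. Type-directed equality: $\Delta\vdash t\Longleftrightarrow_{\mathsf{tm}}t':T$ if $T\searrow A$ and $\Delta\vdash t\longleftrightarrow_{\mathsf{tm}}t':A$; $\Delta\vdash t\longleftrightarrow_{\mathsf{tm}}t':(x\star U)\to^{s,s'}T$ if $\Delta.x\star U\vdash t\star x\Longleftrightarrow_{\mathsf{tm}}t'\star x:T$; $\Delta\vdash T\longleftrightarrow_{\mathsf{tm}}T':s$ if $\Delta\vdash T\Longleftrightarrow_{\mathsf{ty}}T'$; $\Delta\vdash t\longleftrightarrow_{\mathsf{tm}}t':N$ for neutral $N$ if $t\searrow n$, $t'\searrow n'$, and $\Delta\vdash n\Longleftrightarrow_{\mathsf{ne}}n':T$ for some $T$. *)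

theory Defs
  imports Main
begin

datatype sort = SetS nat

definition Axiom :: "(sort \<times> sort) set" where
  "Axiom = {(SetS i, SetS (Suc i)) | i. True}"

definition Rule :: "(sort \<times> sort \<times> sort) set" where
  "Rule = {(SetS i, SetS j, SetS (max i j)) | i j. True}"

datatype ann = Rel | Irr

text \<open>
  Expressions modulo alpha-equivalence are represented by de Bruijn terms: \<open>Var 0\<close> is the
  innermost bound variable, and \<open>T\<close> in \<open>Pi a U s s' T\<close> (that is, \<open>(x \<star> U) \<rightarrow>\<^sup>s\<^sup>,\<^sup>s\<^sup>' T\<close>) and \<open>t\<close> in
  \<open>Lam a U t\<close> are in the scope of one additional variable.
\<close>

datatype expr =
    Srt sort
  | Pi ann expr sort sort expr
  | Var nat
  | Lam ann expr expr
  | App ann expr expr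

fun up_ren :: "(nat \<Rightarrow> nat) \<Rightarrow> nat \<Rightarrow> nat" where
  "up_ren r 0 = 0"
| "up_ren r (Suc n) = Suc (r n)"

fun ren :: "(nat \<Rightarrow> nat) \<Rightarrow> expr \<Rightarrow> expr" where
  "ren r (Srt s) = Srt s"
| "ren r (Pi a U s s' T) = Pi a (ren r U) s s' (ren (up_ren r) T)"
| "ren r (Var n) = Var (r n)"
| "ren r (Lam a U t) = Lam a (ren r U) (ren (up_ren r) t)"
| "ren r (App a t u) = App a (ren r t) (ren r u)"

abbreviation weak :: "expr \<Rightarrow> expr" where
  "weak \<equiv> ren Suc"

fun up_sub :: "(nat \<Rightarrow> expr) \<Rightarrow> nat \<Rightarrow> expr" where
  "up_sub \<sigma> 0 = Var 0"
| "up_sub \<sigma> (Suc n) = weak (\<sigma> n)"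

fun sub :: "(nat \<Rightarrow> expr) \<Rightarrow> expr \<Rightarrow> expr" where
  "sub \<sigma> (Srt s) = Srt s"
| "sub \<sigma> (Pi a U s s' T) = Pi a (sub \<sigma> U) s s' (sub (up_sub \<sigma>) T)"
| "sub \<sigma> (Var n) = \<sigma> n"
| "sub \<sigma> (Lam a U t) = Lam a (sub \<sigma> U) (sub (up_sub \<sigma>) t)"
| "sub \<sigma> (App a t u) = App a (sub \<sigma> t) (sub \<sigma> u)"

text \<open>\<open>inst u T\<close> is \<open>[u/x]T\<close> for \<open>x\<close> the variable of index 0; the other indices move down by one.\<close>

definition inst :: "expr \<Rightarrow> expr \<Rightarrow> expr" where
  "inst u T = sub (case_nat u Var) T"

text \<open>
  The most recent context entry comes first. The type in an entry is in the scope of the entries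
  after it in the list, so looking up index \<open>n\<close> weakens the stored type by \<open>Suc n\<close>.
\<close>

type_synonym ctx = "(ann \<times> expr) list"

definition lookup :: "ctx \<Rightarrow> nat \<Rightarrow> ann \<Rightarrow> expr \<Rightarrow> bool" where
  "lookup \<Gamma> n a T \<longleftrightarrow>
     n < length \<Gamma> \<and> fst (\<Gamma> ! n) = a \<and> T = ren (\<lambda>k. k + Suc n) (snd (\<Gamma> ! n))"

definition resurrect :: "ctx \<Rightarrow> ctx" where
  "resurrect \<Gamma> = map (\<lambda>(a, T). (Rel, T)) \<Gamma>"

text \<open>\<open>\<Gamma> \<turnstile> t \<star> T\<close> is typing in the context \<open>ctx_at \<star> \<Gamma>\<close>.\<close>

fun ctx_at :: "ann \<Rightarrow> ctx \<Rightarrow> ctx" where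
  "ctx_at Rel \<Gamma> = \<Gamma>"
| "ctx_at Irr \<Gamma> = resurrect \<Gamma>"

inductive
  wf_ctx :: "ctx \<Rightarrow> bool" ("\<turnstile> _" [50] 50) and
  typing :: "ctx \<Rightarrow> expr \<Rightarrow> expr \<Rightarrow> bool" ("_ \<turnstile> _ \<Colon> _" [50, 50, 50] 50) and
  equal :: "ctx \<Rightarrow> expr \<Rightarrow> expr \<Rightarrow> expr \<Rightarrow> bool" ("_ \<turnstile> _ \<doteq> _ \<Colon> _" [50, 50, 50, 50] 50)
where
  wf_nil: "\<turnstile> []"
| wf_cons: "\<lbrakk> \<turnstile> \<Gamma>; \<Gamma> \<turnstile> T \<Colon> Srt s \<rbrakk> \<Longrightarrow> \<turnstile> (a, T) # \<Gamma>"

| ty_sort: "\<lbrakk> \<turnstile> \<Gamma>; (s, s') \<in> Axiom \<rbrakk> \<Longrightarrow> \<Gamma> \<turnstile> Srt s \<Colon> Srt s'"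
| ty_pi:
    "\<lbrakk> \<Gamma> \<turnstile> U \<Colon> Srt s1; (a, U) # \<Gamma> \<turnstile> T \<Colon> Srt s2; (s1, s2, s3) \<in> Rule \<rbrakk>
     \<Longrightarrow> \<Gamma> \<turnstile> Pi a U s1 s2 T \<Colon> Srt s3"
| ty_var: "\<lbrakk> \<turnstile> \<Gamma>; lookup \<Gamma> x Rel U \<rbrakk> \<Longrightarrow> \<Gamma> \<turnstile> Var x \<Colon> U"
| ty_lam:
    "\<lbrakk> (a, U) # \<Gamma> \<turnstile> t \<Colon> T; \<Gamma> \<turnstile> Pi a U s s' T \<Colon> Srt s'' \<rbrakk>
     \<Longrightarrow> \<Gamma> \<turnstile> Lam a U t \<Colon> Pi a U s s' T"
| ty_app:
    "\<lbrakk> \<Gamma> \<turnstile> t \<Colon> Pi a U s s' T; ctx_at a \<Gamma> \<turnstile> u \<Colon> U \<rbrakk>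
     \<Longrightarrow> \<Gamma> \<turnstile> App a t u \<Colon> inst u T"
| ty_conv: "\<lbrakk> \<Gamma> \<turnstile> t \<Colon> T; \<Gamma> \<turnstile> T \<doteq> T' \<Colon> Srt s \<rbrakk> \<Longrightarrow> \<Gamma> \<turnstile> t \<Colon> T'"

| eq_beta:
    "\<lbrakk> (a, U) # \<Gamma> \<turnstile> t \<Colon> T; ctx_at a \<Gamma> \<turnstile> u \<Colon> U \<rbrakk>
     \<Longrightarrow> \<Gamma> \<turnstile> App a (Lam a U t) u \<doteq> inst u t \<Colon> inst u T"
| eq_eta:
    "\<Gamma> \<turnstile> t \<Colon> Pi a U s s' T
     \<Longrightarrow> \<Gamma> \<turnstile> t \<doteq> Lam a U (App a (weak t) (Var 0)) \<Colon> Pi a U s s' T"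
| eq_refl: "\<Gamma> \<turnstile> t \<Colon> T \<Longrightarrow> \<Gamma> \<turnstile> t \<doteq> t \<Colon> T"
| eq_sym: "\<Gamma> \<turnstile> t \<doteq> t' \<Colon> T \<Longrightarrow> \<Gamma> \<turnstile> t' \<doteq> t \<Colon> T"
| eq_trans: "\<lbrakk> \<Gamma> \<turnstile> t1 \<doteq> t2 \<Colon> T; \<Gamma> \<turnstile> t2 \<doteq> t3 \<Colon> T \<rbrakk> \<Longrightarrow> \<Gamma> \<turnstile> t1 \<doteq> t3 \<Colon> T"
| eq_pi:
    "\<lbrakk> \<Gamma> \<turnstile> U \<doteq> U' \<Colon> Srt s1; (a, U) # \<Gamma> \<turnstile> T \<doteq> T' \<Colon> Srt s2; (s1, s2, s3) \<in> Rule \<rbrakk>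
     \<Longrightarrow> \<Gamma> \<turnstile> Pi a U s1 s2 T \<doteq> Pi a U' s1 s2 T' \<Colon> Srt s3"
| eq_lam:
    "\<lbrakk> \<Gamma> \<turnstile> U \<doteq> U' \<Colon> Srt s1; (a, U) # \<Gamma> \<turnstile> T \<Colon> Srt s2; (a, U) # \<Gamma> \<turnstile> t \<doteq> t' \<Colon> T \<rbrakk>
     \<Longrightarrow> \<Gamma> \<turnstile> Lam a U t \<doteq> Lam a U' t' \<Colon> Pi a U s1 s2 T"
| eq_app_rel:
    "\<lbrakk> \<Gamma> \<turnstile> t \<doteq> t' \<Colon> Pi Rel U s s' T; \<Gamma> \<turnstile> u \<doteq> u' \<Colon> U \<rbrakk>
     \<Longrightarrow> \<Gamma> \<turnstile> App Rel t u \<doteq> App Rel t' u' \<Colon> inst u T"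
| eq_app_irr:
    "\<lbrakk> \<Gamma> \<turnstile> t \<doteq> t' \<Colon> Pi Irr U s s' T; resurrect \<Gamma> \<turnstile> u \<Colon> U; resurrect \<Gamma> \<turnstile> u' \<Colon> U \<rbrakk>
     \<Longrightarrow> \<Gamma> \<turnstile> App Irr t u \<doteq> App Irr t' u' \<Colon> inst u T"
| eq_conv: "\<lbrakk> \<Gamma> \<turnstile> t \<doteq> t' \<Colon> T; \<Gamma> \<turnstile> T \<doteq> T' \<Colon> Srt s \<rbrakk> \<Longrightarrow> \<Gamma> \<turnstile> t \<doteq> t' \<Colon> T'"

fun neutral :: "expr \<Rightarrow> bool" where
  "neutral (Var x) = True"
| "neutral (App a n u) = neutral n"
| "neutral _ = False"

fun whnf :: "expr \<Rightarrow> bool" where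
  "whnf (Srt s) = True"
| "whnf (Pi a U s s' T) = True"
| "whnf (Lam a U t) = True"
| "whnf n = neutral n"

text \<open>\<open>eval_app f a u v\<close> is active application \<open>f @\<^sup>\<star> u \<searrow> v\<close>, with annotation \<open>a\<close> for \<open>\<star>\<close>.\<close>

inductive
  eval :: "expr \<Rightarrow> expr \<Rightarrow> bool" (infix "\<searrow>" 50) and
  eval_app :: "expr \<Rightarrow> ann \<Rightarrow> expr \<Rightarrow> expr \<Rightarrow> bool"
where
  ev_whnf: "whnf v \<Longrightarrow> v \<searrow> v"
| ev_app: "\<lbrakk> t \<searrow> f; eval_app f a u v \<rbrakk> \<Longrightarrow> App a t u \<searrow> v"
| ev_beta: "inst u t \<searrow> v \<Longrightarrow> eval_app (Lam a U t) a u v"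
| ev_ne: "neutral n \<Longrightarrow> eval_app n a u (App a n u)"

text \<open>
  The constants ending in \<open>w\<close> are the single-arrow judgements, whose types are in weak head
  normal form. In the two structural judgements (\<open>alg_ne\<close>, \<open>alg_new\<close>) the type is an output, and
  both sides are neutral by construction (lemma \<open>ne_neutral\<close>), so their rules carry no explicit
  neutrality premise.
\<close>

inductive
  alg_ty :: "ctx \<Rightarrow> expr \<Rightarrow> expr \<Rightarrow> bool"
    ("_ \<turnstile> _ \<Longleftrightarrow>\<^sub>t\<^sub>y _" [50, 50, 50] 50) and
  alg_tyw :: "ctx \<Rightarrow> expr \<Rightarrow> expr \<Rightarrow> bool"
    ("_ \<turnstile> _ \<longleftrightarrow>\<^sub>t\<^sub>y _" [50, 50, 50] 50) and
  alg_ne :: "ctx \<Rightarrow> expr \<Rightarrow> expr \<Rightarrow> expr \<Rightarrow> bool"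
    ("_ \<turnstile> _ \<Longleftrightarrow>\<^sub>n\<^sub>e _ \<Colon> _" [50, 50, 50, 50] 50) and
  alg_new :: "ctx \<Rightarrow> expr \<Rightarrow> expr \<Rightarrow> expr \<Rightarrow> bool"
    ("_ \<turnstile> _ \<longleftrightarrow>\<^sub>n\<^sub>e _ \<Colon> _" [50, 50, 50, 50] 50) and
  alg_tm :: "ctx \<Rightarrow> expr \<Rightarrow> expr \<Rightarrow> expr \<Rightarrow> bool"
    ("_ \<turnstile> _ \<Longleftrightarrow>\<^sub>t\<^sub>m _ \<Colon> _" [50, 50, 50, 50] 50) and
  alg_tmw :: "ctx \<Rightarrow> expr \<Rightarrow> expr \<Rightarrow> expr \<Rightarrow> bool"
    ("_ \<turnstile> _ \<longleftrightarrow>\<^sub>t\<^sub>m _ \<Colon> _" [50, 50, 50, 50] 50)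
where
  aty: "\<lbrakk> T \<searrow> A; T' \<searrow> A'; \<Delta> \<turnstile> A \<longleftrightarrow>\<^sub>t\<^sub>y A' \<rbrakk> \<Longrightarrow> \<Delta> \<turnstile> T \<Longleftrightarrow>\<^sub>t\<^sub>y T'"

| atyw_sort: "\<Delta> \<turnstile> Srt s \<longleftrightarrow>\<^sub>t\<^sub>y Srt s"
| atyw_pi:
    "\<lbrakk> \<Delta> \<turnstile> U \<Longleftrightarrow>\<^sub>t\<^sub>y U'; (a, U) # \<Delta> \<turnstile> T \<Longleftrightarrow>\<^sub>t\<^sub>y T' \<rbrakk>
     \<Longrightarrow> \<Delta> \<turnstile> Pi a U s s' T \<longleftrightarrow>\<^sub>t\<^sub>y Pi a U' s s' T'"
| atyw_ne:
    "\<lbrakk> neutral N; neutral N'; \<Delta> \<turnstile> N \<Longleftrightarrow>\<^sub>n\<^sub>e N' \<Colon> T \<rbrakk> \<Longrightarrow> \<Delta> \<turnstile> N \<longleftrightarrow>\<^sub>t\<^sub>y N'"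

| ane_var: "lookup \<Delta> x Rel T \<Longrightarrow> \<Delta> \<turnstile> Var x \<Longleftrightarrow>\<^sub>n\<^sub>e Var x \<Colon> T"
| ane_app_rel:
    "\<lbrakk> \<Delta> \<turnstile> n \<longleftrightarrow>\<^sub>n\<^sub>e n' \<Colon> Pi Rel U s s' T; \<Delta> \<turnstile> u \<Longleftrightarrow>\<^sub>t\<^sub>m u' \<Colon> U \<rbrakk>
     \<Longrightarrow> \<Delta> \<turnstile> App Rel n u \<Longleftrightarrow>\<^sub>n\<^sub>e App Rel n' u' \<Colon> inst u T"
| ane_app_irr:
    "\<Delta> \<turnstile> n \<longleftrightarrow>\<^sub>n\<^sub>e n' \<Colon> Pi Irr U s s' T
     \<Longrightarrow> \<Delta> \<turnstile> App Irr n u \<Longleftrightarrow>\<^sub>n\<^sub>e App Irr n' u' \<Colon> inst u T"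

| anew: "\<lbrakk> \<Delta> \<turnstile> n \<Longleftrightarrow>\<^sub>n\<^sub>e n' \<Colon> T; T \<searrow> A \<rbrakk> \<Longrightarrow> \<Delta> \<turnstile> n \<longleftrightarrow>\<^sub>n\<^sub>e n' \<Colon> A"

| atm: "\<lbrakk> T \<searrow> A; \<Delta> \<turnstile> t \<longleftrightarrow>\<^sub>t\<^sub>m t' \<Colon> A \<rbrakk> \<Longrightarrow> \<Delta> \<turnstile> t \<Longleftrightarrow>\<^sub>t\<^sub>m t' \<Colon> T"

| atmw_pi:
    "(a, U) # \<Delta> \<turnstile> App a (weak t) (Var 0) \<Longleftrightarrow>\<^sub>t\<^sub>m App a (weak t') (Var 0) \<Colon> T
     \<Longrightarrow> \<Delta> \<turnstile> t \<longleftrightarrow>\<^sub>t\<^sub>m t' \<Colon> Pi a U s s' T"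
| atmw_sort: "\<Delta> \<turnstile> T \<Longleftrightarrow>\<^sub>t\<^sub>y T' \<Longrightarrow> \<Delta> \<turnstile> T \<longleftrightarrow>\<^sub>t\<^sub>m T' \<Colon> Srt s"
| atmw_ne:
    "\<lbrakk> neutral N; t \<searrow> n; t' \<searrow> n'; neutral n; neutral n'; \<Delta> \<turnstile> n \<Longleftrightarrow>\<^sub>n\<^sub>e n' \<Colon> T \<rbrakk>
     \<Longrightarrow> \<Delta> \<turnstile> t \<longleftrightarrow>\<^sub>t\<^sub>m t' \<Colon> N"

lemma ne_neutral:
  shows "\<Delta> \<turnstile> T \<Longleftrightarrow>\<^sub>t\<^sub>y T' \<Longrightarrow> True"
    and "\<Delta> \<turnstile> A \<longleftrightarrow>\<^sub>t\<^sub>y A' \<Longrightarrow> True"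
    and "\<Delta> \<turnstile> n \<Longleftrightarrow>\<^sub>n\<^sub>e n' \<Colon> B \<Longrightarrow> neutral n \<and> neutral n'"
    and "\<Delta> \<turnstile> n \<longleftrightarrow>\<^sub>n\<^sub>e n' \<Colon> B \<Longrightarrow> neutral n \<and> neutral n'"
    and "\<Delta> \<turnstile> t \<Longleftrightarrow>\<^sub>t\<^sub>m t' \<Colon> B \<Longrightarrow> True"
    and "\<Delta> \<turnstile> t \<longleftrightarrow>\<^sub>t\<^sub>m t' \<Colon> B \<Longrightarrow> True"
  by (induction rule: alg_ty_alg_tyw_alg_ne_alg_new_alg_tm_alg_tmw.inducts) auto

end

theory Submission
  imports Defs
begin

text \<open>
  Two terms are shown to have a common long normal form; since the algorithm only tracks the type
  of the left-hand side, two terms with the same normal form, even in different contexts and at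
  different types, are related by it. As normal forms are unique, having a common one is trivially
  symmetric and transitive, so neither soundness of the algorithm nor injectivity of function types
  is needed. Common normal forms are obtained from a Kripke logical relation whose base case,
  at neutral types, is having a common normal form.
\<close>

section \<open>Substitution and evaluation\<close>

text \<open>The algorithmic rule for function types extends the context by the left domain only, so
  an induction that compares two terms directly gets stuck on replacing \<open>U\<close> by
  \<open>U'\<close> in the context. Normal forms avoid this: each side is normalised in its own
  context, and \<open>nf\<close> records neither contexts nor the types of neutral terms. What
  remains is that both sides arrive at the same normal form, although the domain of a function type,
  hence the context in which its body is normalised, is known only up to semantic equality. This is
  why judgements such as \<open>wtmnf\<close> quantify over all semantically equal types: a normal
  form found once for a fresh variable of type \<open>U\<close> then serves under every
  representative of \<open>U\<close>. Eta at function types forces reading back terms and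
  interpreting neutral terms to be proved together. A derivable equality is interpreted in the world
  \<open>{\<Gamma>}\<close> under the identity substitution and read back there.\<close>

lemma up_ren_comp: "up_ren r (up_ren q n) = up_ren (\<lambda>x. r (q x)) n"
  by (cases n) auto

lemma ren_ren: "ren r (ren q t) = ren (\<lambda>x. r (q x)) t"
  by (induction t arbitrary: r q) (auto simp: up_ren_comp)

lemma up_ren_id: "up_ren (\<lambda>x. x) = (\<lambda>x. x)"
proof
  show "up_ren (\<lambda>x. x) n = n" for n by (cases n) auto
qed

lemma ren_id [simp]: "ren (\<lambda>x. x) t = t"
  by (induction t) (auto simp: up_ren_id)

lemma up_sub_up_ren: "up_sub \<sigma> (up_ren r n) = up_sub (\<lambda>x. \<sigma> (r x)) n"
  by (cases n) auto

lemma sub_ren: "sub \<sigma> (ren r t) = sub (\<lambda>x. \<sigma> (r x)) t"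
  by (induction t arbitrary: \<sigma> r) (auto simp: up_sub_up_ren)

lemma ren_up_weak: "ren (up_ren r) (weak t) = weak (ren r t)"
  by (simp add: ren_ren)

lemma ren_up_sub: "ren (up_ren r) (up_sub \<sigma> n) = up_sub (\<lambda>x. ren r (\<sigma> x)) n"
  by (cases n) (auto simp: ren_up_weak)

lemma ren_sub: "ren r (sub \<sigma> t) = sub (\<lambda>x. ren r (\<sigma> x)) t"
  by (induction t arbitrary: \<sigma> r) (auto simp: ren_up_sub)

lemma sub_up_weak: "sub (up_sub \<sigma>) (weak t) = weak (sub \<sigma> t)"
  by (simp add: sub_ren ren_sub)

lemma sub_up_sub: "sub (up_sub \<tau>) (up_sub \<sigma> n) = up_sub (\<lambda>x. sub \<tau> (\<sigma> x)) n"
  by (cases n) (auto simp: sub_up_weak)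

lemma sub_sub: "sub \<tau> (sub \<sigma> t) = sub (\<lambda>x. sub \<tau> (\<sigma> x)) t"
  by (induction t arbitrary: \<sigma> \<tau>) (auto simp: sub_up_sub)

lemma up_sub_Var: "up_sub Var = Var"
proof
  show "up_sub Var n = Var n" for n by (cases n) auto
qed

lemma sub_Var [simp]: "sub Var t = t"
  by (induction t) (auto simp: up_sub_Var)

lemma sub_cong: "(\<And>n. \<sigma> n = \<tau> n) \<Longrightarrow> sub \<sigma> t = sub \<tau> t"
  by (rule arg_cong[of \<sigma> \<tau> "\<lambda>s. sub s t"]) auto

text \<open>The codomain \<open>F\<close> transported along \<open>r\<close> and closed by
  \<open>u\<close>, that is \<open>inst u (ren (up_ren r) F)\<close>; it is the type of
  \<open>App a (ren r t) u\<close> for \<open>t\<close> of type \<open>Pi a U s s' F\<close>. As a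
  single substitution it composes easily with others.\<close>

abbreviation clo :: "(nat \<Rightarrow> nat) \<Rightarrow> expr \<Rightarrow> expr \<Rightarrow> expr" where
  "clo r u F \<equiv> sub (case_nat u (\<lambda>x. Var (r x))) F"

lemma inst_ren_up: "inst u (ren (up_ren r) F) = clo r u F"
  unfolding inst_def sub_ren by (rule sub_cong) (auto split: nat.split simp: gr0_conv_Suc elim: up_ren.elims)

text \<open>Going under a binder is weakening followed by application to the fresh variable, so the
  open body \<open>F\<close> is itself an instance of the codomain family.\<close>

lemma clo_Suc_Var: "clo Suc (Var 0) F = F"
proof -
  have "clo Suc (Var 0) F = sub Var F"
    by (rule sub_cong) (auto split: nat.split)
  then show ?thesis by simp
qed

lemma clo_ren_up: "clo q u (ren (up_ren r) F) = clo (\<lambda>x. q (r x)) u F"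
  unfolding sub_ren
proof (rule sub_cong)
  show "(case up_ren r n of 0 \<Rightarrow> u | Suc x \<Rightarrow> Var (q x)) = (case n of 0 \<Rightarrow> u | Suc x \<Rightarrow> Var (q (r x)))" for n
    by (cases n) auto
qed

text \<open>Brings a closed codomain into the form of an extended substitution, which is what
  \<open>sub_eq_cons\<close> provides.\<close>

lemma clo_sub_up: "clo q u (sub (up_sub \<sigma>) T) = sub (case_nat u (\<lambda>x. ren q (\<sigma> x))) T"
proof -
  have ren_sub_Var: "ren q t = sub (\<lambda>x. Var (q x)) t" for t q
    using ren_sub[of q Var t] by simp
  show ?thesis
    unfolding sub_sub
  proof (rule sub_cong)
    show "clo q u (up_sub \<sigma> n) = (case n of 0 \<Rightarrow> u | Suc x \<Rightarrow> ren q (\<sigma> x))" for n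
      by (cases n) (auto simp: sub_ren ren_sub_Var[symmetric])
  qed
qed

lemma sub_inst: "sub \<sigma> (inst u T) = sub (case_nat (sub \<sigma> u) \<sigma>) T"
  unfolding inst_def sub_sub by (rule sub_cong) (auto split: nat.split)

lemma ren_inst: "ren r (inst u t) = inst (ren r u) (ren (up_ren r) t)"
proof -
  have "ren r (inst u t) = clo r (ren r u) t"
    unfolding inst_def ren_sub by (rule sub_cong) (auto split: nat.split)
  then show ?thesis by (simp add: inst_ren_up)
qed

section \<open>Weak head evaluation: determinism, renaming, expansion\<close>

lemma neutral_whnf: "neutral n \<Longrightarrow> whnf n"
  by (cases n) auto

inductive_cases eval_AppE: "App a t u \<searrow> v"
inductive_cases eval_app_LamE: "eval_app (Lam b U t) a u v"
lemma eval_whnf_eq: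
  shows "t \<searrow> v \<Longrightarrow> whnf t \<Longrightarrow> v = t"
    and "eval_app f a u v \<Longrightarrow> neutral f \<Longrightarrow> v = App a f u"
  by (induction rule: eval_eval_app.inducts) (auto simp: neutral_whnf)

text \<open>The rules overlap only on a neutral application, which evaluates by
  \<open>ev_whnf\<close> as well as by \<open>ev_app\<close> with \<open>ev_ne\<close>;
  \<open>eval_whnf_eq\<close> shows that the results agree.\<close>

lemma eval_eval_app_det:
  shows "t \<searrow> v \<Longrightarrow> t \<searrow> v' \<Longrightarrow> v' = v"
    and "eval_app f a u v \<Longrightarrow> eval_app f a u v' \<Longrightarrow> v' = v"
proof (induction arbitrary: v' and v' rule: eval_eval_app.inducts)
  case (ev_whnf v)
  then show ?case by (simp add: eval_whnf_eq)
next
  case (ev_app t f a u v)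
  from ev_app.prems show ?case
  proof (rule eval_AppE)
    assume *: "v' = App a t u" "neutral t"
    then have "f = t" using ev_app.hyps(1) eval_whnf_eq(1) neutral_whnf by blast
    then show ?thesis using * ev_app.hyps(2) eval_whnf_eq(2) \<open>neutral t\<close> by blast
  next
    fix g assume "t \<searrow> g" "eval_app g a u v'"
    then show ?thesis using ev_app.IH by blast
  qed
next
  case (ev_beta u t v U a)
  from ev_beta.prems show ?case by (rule eval_app_LamE) (auto intro: ev_beta.IH)
next
  case (ev_ne n a u)
  then show ?case using eval_whnf_eq(2) by blast
qed

lemmas eval_det = eval_eval_app_det(1)

lemma neutral_ren [simp]: "neutral (ren r n) = neutral n"
  by (induction n arbitrary: r) auto

lemma whnf_ren [simp]: "whnf (ren r n) = whnf n"
  by (cases n) auto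

lemma eval_eval_app_ren:
  shows "t \<searrow> v \<Longrightarrow> ren r t \<searrow> ren r v"
    and "eval_app f a u v \<Longrightarrow> eval_app (ren r f) a (ren r u) (ren r v)"
  by (induction rule: eval_eval_app.inducts)
     (auto intro: eval_eval_app.intros simp: ren_inst)

lemmas eval_ren = eval_eval_app_ren(1)

text \<open>A small-step companion of evaluation, used for head expansion in the logical relation.
  The congruence \<open>whred_app\<close> carries a step below further arguments, as function types
  require.\<close>

inductive whred :: "expr \<Rightarrow> expr \<Rightarrow> bool" (infix "\<leadsto>" 50) where
  whred_beta: "App a (Lam a U t) u \<leadsto> inst u t"
| whred_app: "t \<leadsto> t' \<Longrightarrow> App a t u \<leadsto> App a t' u"

lemma whred_ren: "t \<leadsto> t' \<Longrightarrow> ren r t \<leadsto> ren r t'"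
  by (induction rule: whred.induct) (auto simp: ren_inst intro: whred.intros)

lemma whred_eval: "t \<leadsto> t' \<Longrightarrow> t' \<searrow> v \<Longrightarrow> t \<searrow> v"
proof (induction arbitrary: v rule: whred.induct)
  case (whred_beta a U t u)
  then have "eval_app (Lam a U t) a u v" by (rule ev_beta)
  moreover have "Lam a U t \<searrow> Lam a U t" by (simp add: ev_whnf)
  ultimately show ?case by (blast intro: ev_app)
next
  case (whred_app t t' a u)
  from whred_app.prems show ?case
  proof (rule eval_AppE)
    \<comment> \<open>Here \<open>t'\<close> is neutral but its expansion \<open>t\<close> need not
      be, so \<open>ev_whnf\<close> has to be replaced by \<open>ev_app\<close> with
      \<open>ev_ne\<close>.\<close>
    assume *: "v = App a t' u" "neutral t'"
    then have "t \<searrow> t'" by (blast intro: whred_app.IH ev_whnf neutral_whnf)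
    then show ?thesis using * by (blast intro: ev_app ev_ne)
  next
    fix f assume "t' \<searrow> f" "eval_app f a u v"
    then show ?thesis by (blast intro: ev_app whred_app.IH)
  qed
qed

section \<open>Long normal forms\<close>

text \<open>One datatype for three classes: types (\<open>NSrt\<close>, \<open>NPi\<close>,
  \<open>NTyNe\<close>), neutral terms (\<open>NVar\<close>, \<open>NAppRel\<close>,
  \<open>NAppIrr\<close>) and terms (\<open>NLam\<close>, \<open>NTy\<close>, \<open>NNe\<close>).
  Each constructor belongs to exactly one rule below, so a normal form reveals the last rule of its
  derivation.\<close>

datatype nf =
    NSrt sort
  | NPi ann nf sort sort nf
  | NTyNe nf
  | NVar nat
  | NAppRel nf nf
  | NAppIrr nf
  | NLam ann nf
  | NTy nf
  | NNe nf

text \<open>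
  Domain annotations of abstractions and irrelevant arguments do not appear in the normal form.
\<close>

inductive
  tynf :: "ctx \<Rightarrow> expr \<Rightarrow> nf \<Rightarrow> bool" and
  nenf :: "ctx \<Rightarrow> expr \<Rightarrow> nf \<Rightarrow> expr \<Rightarrow> bool" and
  tmnf :: "ctx \<Rightarrow> expr \<Rightarrow> expr \<Rightarrow> nf \<Rightarrow> bool"
where
  tynf_sort: "T \<searrow> Srt s \<Longrightarrow> tynf \<Delta> T (NSrt s)"
| tynf_pi: "\<lbrakk> T \<searrow> Pi a U s s' F; tynf \<Delta> U V; tynf ((a, U) # \<Delta>) F W \<rbrakk> \<Longrightarrow> tynf \<Delta> T (NPi a V s s' W)"
| tynf_ne: "\<lbrakk> T \<searrow> N; neutral N; nenf \<Delta> N m S \<rbrakk> \<Longrightarrow> tynf \<Delta> T (NTyNe m)"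
| nenf_var: "lookup \<Delta> x Rel T \<Longrightarrow> nenf \<Delta> (Var x) (NVar x) T"
| nenf_app_rel: "\<lbrakk> nenf \<Delta> n m S; S \<searrow> Pi Rel U s s' F; tmnf \<Delta> u U v \<rbrakk>
    \<Longrightarrow> nenf \<Delta> (App Rel n u) (NAppRel m v) (inst u F)"
| nenf_app_irr: "\<lbrakk> nenf \<Delta> n m S; S \<searrow> Pi Irr U s s' F \<rbrakk>
    \<Longrightarrow> nenf \<Delta> (App Irr n u) (NAppIrr m) (inst u F)"
| tmnf_pi: "\<lbrakk> T \<searrow> Pi a U s s' F; tmnf ((a, U) # \<Delta>) (App a (weak t) (Var 0)) F v \<rbrakk>
    \<Longrightarrow> tmnf \<Delta> t T (NLam a v)"
| tmnf_sort: "\<lbrakk> T \<searrow> Srt s; tynf \<Delta> t V \<rbrakk> \<Longrightarrow> tmnf \<Delta> t T (NTy V)"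
| tmnf_ne: "\<lbrakk> T \<searrow> N; neutral N; t \<searrow> n; neutral n; nenf \<Delta> n m S \<rbrakk> \<Longrightarrow> tmnf \<Delta> t T (NNe m)"

inductive_cases tynf_sortE: "tynf \<Delta> T (NSrt s)"
inductive_cases tynf_piE: "tynf \<Delta> T (NPi a V s s' W)"
inductive_cases tynf_neE: "tynf \<Delta> T (NTyNe m)"
inductive_cases nenf_varE: "nenf \<Delta> n (NVar x) S"
inductive_cases nenf_app_relE: "nenf \<Delta> n (NAppRel m v) S"
inductive_cases nenf_app_irrE: "nenf \<Delta> n (NAppIrr m) S"
inductive_cases tmnf_piE: "tmnf \<Delta> t T (NLam a v)"
inductive_cases tmnf_sortE: "tmnf \<Delta> t T (NTy V)"
inductive_cases tmnf_neE: "tmnf \<Delta> t T (NNe m)"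

text \<open>Induction on the left derivation; the head of the shared normal form then inverts the
  right one. Contexts and types in the conclusion come from the left, so those on the right may be
  unrelated.\<close>

lemma nf_alg:
  shows "tynf \<Delta> T V \<Longrightarrow> tynf \<Delta>' T' V \<Longrightarrow> \<Delta> \<turnstile> T \<Longleftrightarrow>\<^sub>t\<^sub>y T'"
    and "nenf \<Delta> n m S \<Longrightarrow> nenf \<Delta>' n' m S' \<Longrightarrow> \<Delta> \<turnstile> n \<Longleftrightarrow>\<^sub>n\<^sub>e n' \<Colon> S"
    and "tmnf \<Delta> t T v \<Longrightarrow> tmnf \<Delta>' t' T' v \<Longrightarrow> \<Delta> \<turnstile> t \<Longleftrightarrow>\<^sub>t\<^sub>m t' \<Colon> T"
proof (induction arbitrary: \<Delta>' T' and \<Delta>' n' S' and \<Delta>' t' T' rule: tynf_nenf_tmnf.inducts)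
  case tynf_sort
  from tynf_sort.prems show ?case
    by (rule tynf_sortE) (auto intro: tynf_sort.hyps aty atyw_sort)
next
  case tynf_pi
  from tynf_pi.prems show ?case
    by (rule tynf_piE) (blast intro: tynf_pi.hyps tynf_pi.IH aty atyw_pi)
next
  case tynf_ne
  from tynf_ne.prems show ?case
    by (rule tynf_neE) (blast intro: tynf_ne.hyps tynf_ne.IH aty atyw_ne)
next
  case nenf_var
  from nenf_var.prems show ?case
    by (rule nenf_varE) (auto intro: nenf_var.hyps ane_var)
next
  case nenf_app_rel
  from nenf_app_rel.prems show ?case
    by (rule nenf_app_relE) (auto intro: nenf_app_rel.hyps nenf_app_rel.IH ane_app_rel anew)
next
  case nenf_app_irr
  from nenf_app_irr.prems show ?case
    by (rule nenf_app_irrE) (auto intro: nenf_app_irr.hyps nenf_app_irr.IH ane_app_irr anew)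
next
  case tmnf_pi
  from tmnf_pi.prems show ?case
    by (rule tmnf_piE) (blast intro: tmnf_pi.hyps tmnf_pi.IH atm atmw_pi)
next
  case tmnf_sort
  from tmnf_sort.prems show ?case
    by (rule tmnf_sortE) (blast intro: tmnf_sort.hyps tmnf_sort.IH atm atmw_sort)
next
  case tmnf_ne
  from tmnf_ne.prems show ?case
    by (rule tmnf_neE) (blast intro: tmnf_ne.hyps tmnf_ne.IH atm atmw_ne)
qed

section \<open>Uniqueness of normal forms\<close>

inductive_cases nenf_VarE: "nenf \<Delta> (Var x) m S"
inductive_cases nenf_AppRelE: "nenf \<Delta> (App Rel n u) m S"
inductive_cases nenf_AppIrrE: "nenf \<Delta> (App Irr n u) m S"
inductive_cases tynfE: "tynf \<Delta> T V"
inductive_cases tmnfE: "tmnf \<Delta> t T v"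

lemma lookup_det: "lookup \<Delta> x a T \<Longrightarrow> lookup \<Delta> x a' T' \<Longrightarrow> T = T'"
  by (simp add: lookup_def)

text \<open>Rests on determinism of evaluation and lookup. Uniqueness of the synthesised type
  \<open>S\<close> belongs to the induction, because \<open>S\<close> supplies the type at which an
  argument is normalised.\<close>

lemma nf_det:
  shows "tynf \<Delta> T V \<Longrightarrow> tynf \<Delta> T V' \<Longrightarrow> V = V'"
    and "nenf \<Delta> n m S \<Longrightarrow> nenf \<Delta> n m' S' \<Longrightarrow> m = m' \<and> S = S'"
    and "tmnf \<Delta> t T v \<Longrightarrow> tmnf \<Delta> t T v' \<Longrightarrow> v = v'"
proof (induction arbitrary: V' and m' S' and v' rule: tynf_nenf_tmnf.inducts)
  case tynf_sort
  from tynf_sort.prems show ?case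
    by (rule tynfE) (auto dest!: eval_det[OF tynf_sort.hyps(1)])
next
  case tynf_pi
  from tynf_pi.prems show ?case
    by (rule tynfE) (auto dest!: eval_det[OF tynf_pi.hyps(1)] tynf_pi.IH)
next
  case tynf_ne
  from tynf_ne.prems show ?case
    by (rule tynfE) (use tynf_ne.hyps(2) in \<open>auto dest!: eval_det[OF tynf_ne.hyps(1)] tynf_ne.IH\<close>)
next
  case nenf_var
  from nenf_var.prems show ?case
    by (rule nenf_VarE) (auto dest!: lookup_det[OF nenf_var.hyps])
next
  case nenf_app_rel
  from nenf_app_rel.prems show ?case
    by (rule nenf_AppRelE)
       (auto dest!: nenf_app_rel.IH(1), auto dest!: eval_det[OF nenf_app_rel.hyps(2)] nenf_app_rel.IH(2))
next
  case nenf_app_irr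
  from nenf_app_irr.prems show ?case
    by (rule nenf_AppIrrE)
       (auto dest!: nenf_app_irr.IH, auto dest!: eval_det[OF nenf_app_irr.hyps(2)])
next
  case tmnf_pi
  from tmnf_pi.prems show ?case
    by (rule tmnfE) (auto dest!: eval_det[OF tmnf_pi.hyps(1)] tmnf_pi.IH)
next
  case tmnf_sort
  from tmnf_sort.prems show ?case
    by (rule tmnfE) (auto dest!: eval_det[OF tmnf_sort.hyps(1)] tmnf_sort.IH)
next
  case tmnf_ne
  from tmnf_ne.prems show ?case
    by (rule tmnfE)
       (use tmnf_ne.hyps(2) in \<open>auto dest!: eval_det[OF tmnf_ne.hyps(1)] eval_det[OF tmnf_ne.hyps(3)] tmnf_ne.IH\<close>)
qed

section \<open>Renaming of normal forms\<close>

definition tren :: "(nat \<Rightarrow> nat) \<Rightarrow> ctx \<Rightarrow> ctx \<Rightarrow> bool" where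
  "tren r \<Delta>' \<Delta> \<longleftrightarrow> (\<forall>x T. lookup \<Delta> x Rel T \<longrightarrow> lookup \<Delta>' (r x) Rel (ren r T))"

lemma lookup_0: "lookup ((a, U) # \<Delta>) 0 b T \<longleftrightarrow> a = b \<and> T = weak U"
  by (auto simp: lookup_def)

lemma lookup_Suc: "lookup ((a, U) # \<Delta>) (Suc x) b T \<longleftrightarrow> (\<exists>T'. lookup \<Delta> x b T' \<and> T = weak T')"
  by (auto simp: lookup_def ren_ren)

lemma tren_id: "tren (\<lambda>x. x) \<Delta> \<Delta>"
  by (simp add: tren_def)

lemma tren_comp: "tren q \<Delta>'' \<Delta>' \<Longrightarrow> tren r \<Delta>' \<Delta> \<Longrightarrow> tren (\<lambda>x. q (r x)) \<Delta>'' \<Delta>"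
  unfolding tren_def by (metis ren_ren)

lemma tren_Suc: "tren Suc ((a, U) # \<Delta>) \<Delta>"
  by (auto simp: tren_def lookup_Suc)

lemma tren_up:
  assumes "tren r \<Delta>' \<Delta>"
  shows "tren (up_ren r) ((a, ren r U) # \<Delta>') ((a, U) # \<Delta>)"
  unfolding tren_def
proof (intro allI impI)
  fix x T assume "lookup ((a, U) # \<Delta>) x Rel T"
  then show "lookup ((a, ren r U) # \<Delta>') (up_ren r x) Rel (ren (up_ren r) T)"
    using assms by (cases x) (fastforce simp: lookup_0 lookup_Suc ren_up_weak tren_def)+
qed

primrec nf_ren :: "(nat \<Rightarrow> nat) \<Rightarrow> nf \<Rightarrow> nf" where
  "nf_ren r (NSrt s) = NSrt s"
| "nf_ren r (NPi a V s s' W) = NPi a (nf_ren r V) s s' (nf_ren (up_ren r) W)"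
| "nf_ren r (NTyNe m) = NTyNe (nf_ren r m)"
| "nf_ren r (NVar x) = NVar (r x)"
| "nf_ren r (NAppRel m v) = NAppRel (nf_ren r m) (nf_ren r v)"
| "nf_ren r (NAppIrr m) = NAppIrr (nf_ren r m)"
| "nf_ren r (NLam a v) = NLam a (nf_ren (up_ren r) v)"
| "nf_ren r (NTy V) = NTy (nf_ren r V)"
| "nf_ren r (NNe m) = NNe (nf_ren r m)"

lemma nf_judgements_ren:
  shows "tynf \<Delta> T V \<Longrightarrow> tren r \<Delta>' \<Delta> \<Longrightarrow> tynf \<Delta>' (ren r T) (nf_ren r V)"
    and "nenf \<Delta> n m S \<Longrightarrow> tren r \<Delta>' \<Delta> \<Longrightarrow> nenf \<Delta>' (ren r n) (nf_ren r m) (ren r S)"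
    and "tmnf \<Delta> t T v \<Longrightarrow> tren r \<Delta>' \<Delta> \<Longrightarrow> tmnf \<Delta>' (ren r t) (ren r T) (nf_ren r v)"
proof (induction arbitrary: r \<Delta>' and r \<Delta>' and r \<Delta>' rule: tynf_nenf_tmnf.inducts)
  case (tynf_sort T s \<Delta>)
  then show ?case using eval_ren[of T "Srt s" r] by (auto intro: tynf_nenf_tmnf.intros)
next
  case (tynf_pi T a U s s' F \<Delta> V W)
  show ?case unfolding nf_ren.simps
    by (rule tynf_nenf_tmnf.tynf_pi)
       (use tynf_pi eval_ren[of T "Pi a U s s' F" r] tren_up in auto)
next
  case tynf_ne
  then show ?case by (auto intro!: tynf_nenf_tmnf.tynf_ne eval_ren)
next
  case nenf_var
  then show ?case by (auto simp: tren_def intro!: tynf_nenf_tmnf.nenf_var)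
next
  case (nenf_app_rel \<Delta> n m S U s s' F u v)
  then show ?case using eval_ren[of S "Pi Rel U s s' F" r]
    by (auto intro!: tynf_nenf_tmnf.nenf_app_rel simp: ren_inst)
next
  case (nenf_app_irr \<Delta> n m S U s s' F u)
  then show ?case using eval_ren[of S "Pi Irr U s s' F" r]
    by (auto intro!: tynf_nenf_tmnf.nenf_app_irr simp: ren_inst)
next
  case (tmnf_pi T a U s s' F \<Delta> t v)
  from tmnf_pi.IH[OF tren_up[OF tmnf_pi.prems]]
  show ?case using eval_ren[OF tmnf_pi.hyps(1), of r]
    by (auto intro!: tynf_nenf_tmnf.tmnf_pi simp: ren_up_weak)
next
  case (tmnf_sort T s \<Delta> t V)
  then show ?case using eval_ren[of T "Srt s" r] by (auto intro: tynf_nenf_tmnf.tmnf_sort)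
next
  case (tmnf_ne T N t n \<Delta> m S)
  show ?case unfolding nf_ren.simps
    by (rule tynf_nenf_tmnf.tmnf_ne[of _ "ren r N" _ "ren r n"]) (use tmnf_ne eval_ren in auto)
qed

section \<open>The logical relation\<close>

text \<open>
  A world is a nonempty set of contexts, to be thought of as one context up to semantic equality
  of its types. This is what lets both sides of a judgement extend the context by different but
  equal domains without any context conversion for the algorithm.
\<close>

definition ext :: "(nat \<Rightarrow> nat) \<Rightarrow> ctx set \<Rightarrow> ctx set \<Rightarrow> bool" where
  "ext r w' w \<longleftrightarrow> w' \<noteq> {} \<and> (\<forall>\<Delta>'\<in>w'. \<exists>\<Delta>\<in>w. tren r \<Delta>' \<Delta>)"

lemma ext_id: "w \<noteq> {} \<Longrightarrow> ext (\<lambda>x. x) w w"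
  unfolding ext_def using tren_id by blast

lemma ext_comp: "ext q w'' w' \<Longrightarrow> ext r w' w \<Longrightarrow> ext (\<lambda>x. q (r x)) w'' w"
  unfolding ext_def using tren_comp by meson

lemma ext_nonempty: "ext r w' w \<Longrightarrow> w' \<noteq> {}"
  by (simp add: ext_def)

text \<open>The synthesised type may depend on the context, since the contexts of a world agree only
  up to semantic equality; the normal form may not.\<close>

definition wnenf :: "ctx set \<Rightarrow> expr \<Rightarrow> nf \<Rightarrow> bool" where
  "wnenf w n m \<longleftrightarrow> (\<forall>\<Delta>\<in>w. \<exists>S. nenf \<Delta> n m S)"

definition neeq :: "ctx set \<Rightarrow> expr \<Rightarrow> expr \<Rightarrow> bool" where
  "neeq w n n' \<longleftrightarrow> (\<exists>m. wnenf w n m \<and> wnenf w n' m)"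

lemma wnenf_ren: "wnenf w n m \<Longrightarrow> ext r w' w \<Longrightarrow> wnenf w' (ren r n) (nf_ren r m)"
  unfolding wnenf_def ext_def using nf_judgements_ren(2) by meson

text \<open>Any one context of the world lets \<open>nf_det\<close> apply. This is where nonempty
  worlds matter: in the empty world every \<open>m\<close> is a normal form of every
  \<open>n\<close>.\<close>

lemma wnenf_det: "wnenf w n m \<Longrightarrow> wnenf w n m' \<Longrightarrow> w \<noteq> {} \<Longrightarrow> m = m'"
  unfolding wnenf_def using nf_det(2) by blast

lemma neeq_ren: "neeq w n n' \<Longrightarrow> ext r w' w \<Longrightarrow> neeq w' (ren r n) (ren r n')"
  unfolding neeq_def using wnenf_ren by blast

lemma neeq_sym: "neeq w n n' \<Longrightarrow> neeq w n' n"
  unfolding neeq_def by blast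

lemma neeq_trans: "neeq w n n' \<Longrightarrow> neeq w n' n'' \<Longrightarrow> w \<noteq> {} \<Longrightarrow> neeq w n n''"
  unfolding neeq_def using wnenf_det by blast

definition netm :: "ctx set \<Rightarrow> expr \<Rightarrow> expr \<Rightarrow> bool" where
  "netm w t t' \<longleftrightarrow> (\<exists>n n'. t \<searrow> n \<and> t' \<searrow> n' \<and> neutral n \<and> neutral n' \<and> neeq w n n')"

text \<open>
  For an irrelevant function type the arguments are arbitrary, even ill-typed, expressions:
  irrelevant variables are never looked up and irrelevant arguments never compared, so resurrected
  judgements need no interpretation at all.
\<close>

definition pitm :: "ann \<Rightarrow> ctx set \<Rightarrow> ((nat \<Rightarrow> nat) \<Rightarrow> ctx set \<Rightarrow> expr \<Rightarrow> expr \<Rightarrow> bool) \<Rightarrow>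
    ((nat \<Rightarrow> nat) \<Rightarrow> ctx set \<Rightarrow> expr \<Rightarrow> expr \<Rightarrow> expr \<Rightarrow> expr \<Rightarrow> bool) \<Rightarrow> expr \<Rightarrow> expr \<Rightarrow> bool" where
  "pitm a w P Q t t' \<longleftrightarrow> (\<forall>r w' u u'. ext r w' w \<longrightarrow> (a = Rel \<longrightarrow> P r w' u u') \<longrightarrow>
     Q r w' u u' (App a (ren r t) u) (App a (ren r t') u'))"

text \<open>
  Inductive-recursive definition in graph form: the last argument is the equality of terms that
  comes with the equality of types, and \<open>L\<close> supplies the relations for the smaller universes.
  The level \<open>n\<close> only bounds the sorts that occur, so the relation is cumulative although the
  type theory is not.
\<close>

inductive LRI :: "nat \<Rightarrow> (nat \<Rightarrow> ctx set \<Rightarrow> expr \<Rightarrow> expr \<Rightarrow> (expr \<Rightarrow> expr \<Rightarrow> bool) \<Rightarrow> bool) \<Rightarrow>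
    ctx set \<Rightarrow> expr \<Rightarrow> expr \<Rightarrow> (expr \<Rightarrow> expr \<Rightarrow> bool) \<Rightarrow> bool"
  for n L where
  LRI_sort: "\<lbrakk> w \<noteq> {}; T \<searrow> Srt (SetS j); T' \<searrow> Srt (SetS j); j < n \<rbrakk>
    \<Longrightarrow> LRI n L w T T' (\<lambda>t t'. \<exists>R. L j w t t' R)"
| LRI_ne: "\<lbrakk> w \<noteq> {}; netm w T T' \<rbrakk> \<Longrightarrow> LRI n L w T T' (netm w)"
| LRI_pi: "\<lbrakk> w \<noteq> {}; T \<searrow> Pi a U s s' F; T' \<searrow> Pi a U' s s' F';
    \<And>r w'. ext r w' w \<Longrightarrow> LRI n L w' (ren r U) (ren r U') (P r w');
    \<And>r w' u u'. ext r w' w \<Longrightarrow> (a = Rel \<longrightarrow> P r w' u u') \<Longrightarrow>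
      LRI n L w' (clo r u F) (clo r u' F') (Q r w' u u') \<rbrakk>
    \<Longrightarrow> LRI n L w T T' (pitm a w P Q)"

text \<open>The guard makes the recursive calls visibly decreasing; \<open>LRI_sort\<close> consults
  \<open>L j\<close> only for \<open>j < n\<close>, where it is \<open>LR j\<close>.\<close>

function LR :: "nat \<Rightarrow> ctx set \<Rightarrow> expr \<Rightarrow> expr \<Rightarrow> (expr \<Rightarrow> expr \<Rightarrow> bool) \<Rightarrow> bool" where
  "LR n = LRI n (\<lambda>j. if j < n then LR j else (\<lambda>_ _ _ _. False))"
  by pat_completeness auto
termination by (relation "measure id") auto

declare LR.simps [simp del]

lemma LR_sort:
  assumes "w \<noteq> {}" "T \<searrow> Srt (SetS j)" "T' \<searrow> Srt (SetS j)" "j < n"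
  shows "LR n w T T' (\<lambda>t t'. \<exists>R. LR j w t t' R)"
  using LRI_sort[OF assms, of "\<lambda>j. if j < n then LR j else (\<lambda>_ _ _ _. False)"] assms(4)
  by (simp add: LR.simps[of n])

lemma LR_ne: "w \<noteq> {} \<Longrightarrow> netm w T T' \<Longrightarrow> LR n w T T' (netm w)"
  unfolding LR.simps[of n] by (rule LRI_ne)

lemma LR_pi:
  assumes "w \<noteq> {}" "T \<searrow> Pi a U s s' F" "T' \<searrow> Pi a U' s s' F'"
    "\<And>r w'. ext r w' w \<Longrightarrow> LR n w' (ren r U) (ren r U') (P r w')"
    "\<And>r w' u u'. ext r w' w \<Longrightarrow> (a = Rel \<longrightarrow> P r w' u u') \<Longrightarrow>
      LR n w' (clo r u F) (clo r u' F') (Q r w' u u')"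
  shows "LR n w T T' (pitm a w P Q)"
  using assms unfolding LR.simps[of n] by (rule LRI_pi)

text \<open>Combines well-founded induction on the level with rule induction, so that at a sort
  there is an induction hypothesis for all types of the smaller universe.\<close>

lemma LR_induct [consumes 1, case_names sort ne pi]:
  assumes "LR n w T T' R"
    and sort: "\<And>n w T T' j. \<lbrakk> w \<noteq> {}; T \<searrow> Srt (SetS j); T' \<searrow> Srt (SetS j); j < n;
      \<And>w T T' R. LR j w T T' R \<Longrightarrow> X j w T T' R \<rbrakk> \<Longrightarrow> X n w T T' (\<lambda>t t'. \<exists>R. LR j w t t' R)"
    and ne: "\<And>n w T T'. \<lbrakk> w \<noteq> {}; netm w T T' \<rbrakk> \<Longrightarrow> X n w T T' (netm w)"
    and pi: "\<And>n w T T' a U s s' F U' F' P Q. \<lbrakk> w \<noteq> {}; T \<searrow> Pi a U s s' F; T' \<searrow> Pi a U' s s' F';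
      \<And>r w'. ext r w' w \<Longrightarrow> LR n w' (ren r U) (ren r U') (P r w');
      \<And>r w'. ext r w' w \<Longrightarrow> X n w' (ren r U) (ren r U') (P r w');
      \<And>r w' u u'. ext r w' w \<Longrightarrow> (a = Rel \<longrightarrow> P r w' u u') \<Longrightarrow>
        LR n w' (clo r u F) (clo r u' F') (Q r w' u u');
      \<And>r w' u u'. ext r w' w \<Longrightarrow> (a = Rel \<longrightarrow> P r w' u u') \<Longrightarrow>
        X n w' (clo r u F) (clo r u' F') (Q r w' u u') \<rbrakk> \<Longrightarrow> X n w T T' (pitm a w P Q)"
  shows "X n w T T' R"
  using assms(1)
proof (induction n arbitrary: w T T' R rule: less_induct)
  case (less n)
  from less.prems show ?case
    unfolding LR.simps[of n]
  proof (induction rule: LRI.induct)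
    case (LRI_sort w T j T')
    from sort[OF LRI_sort less.IH[OF LRI_sort(4)]] LRI_sort(4) show ?case by simp
  next
    case (LRI_ne w T T')
    then show ?case by (rule ne)
  next
    case (LRI_pi w T a U s s' F T' U' F' P Q)
    show ?case
      by (rule pi[OF LRI_pi.hyps(1-3)]) (simp_all add: LRI_pi.hyps LRI_pi.IH LR.simps[of n])
  qed
qed

lemma LR_cases [consumes 1, case_names sort ne pi]:
  assumes "LR n w T T' R"
  obtains (sort) j where "w \<noteq> {}" "T \<searrow> Srt (SetS j)" "T' \<searrow> Srt (SetS j)" "j < n"
      "R = (\<lambda>t t'. \<exists>R. LR j w t t' R)"
  | (ne) "w \<noteq> {}" "netm w T T'" "R = netm w"
  | (pi) a U s s' F U' F' P Q where "w \<noteq> {}" "T \<searrow> Pi a U s s' F" "T' \<searrow> Pi a U' s s' F'"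
      "\<And>r w'. ext r w' w \<Longrightarrow> LR n w' (ren r U) (ren r U') (P r w')"
      "\<And>r w' u u'. ext r w' w \<Longrightarrow> (a = Rel \<longrightarrow> P r w' u u') \<Longrightarrow>
        LR n w' (clo r u F) (clo r u' F') (Q r w' u u')"
      "R = pitm a w P Q"
proof -
  let ?L = "\<lambda>j. if j < n then LR j else (\<lambda>_ _ _ _. False)"
  from assms have "LRI n ?L w T T' R" by (simp add: LR.simps[of n])
  then show ?thesis
  proof cases
    case (LRI_sort j)
    then show ?thesis using that(1)[of j] by simp
  next
    case LRI_ne
    then show ?thesis using that(2) by simp
  next
    case (LRI_pi a U s s' F U' F' P Q)
    then show ?thesis using that(3)[of a U s s' F U' F' P Q] by (simp add: LR.simps[of n])
  qed
qed

section \<open>Inversion, functionality and equivalence\<close>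

lemma LR_nonempty: "LR n w T T' R \<Longrightarrow> w \<noteq> {}"
  by (erule LR_cases)

lemma LR_sort_inv:
  assumes "LR n w T T' R" "T \<searrow> Srt (SetS j)"
  shows "T' \<searrow> Srt (SetS j) \<and> j < n \<and> R = (\<lambda>t t'. \<exists>R. LR j w t t' R)"
  using assms(1)
  by (cases rule: LR_cases) (auto dest!: eval_det[OF assms(2)] simp: netm_def)

lemma LR_ne_inv:
  assumes "LR n w T T' R" "T \<searrow> N" "neutral N"
  shows "netm w T T' \<and> R = netm w"
  using assms(1,3)
  by (cases rule: LR_cases) (auto dest!: eval_det[OF assms(2)])

lemma LR_pi_inv:
  assumes "LR n w T T' R" "T \<searrow> Pi a U s s' F"
  obtains U' F' P Q where "T' \<searrow> Pi a U' s s' F'"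
    "\<And>r w'. ext r w' w \<Longrightarrow> LR n w' (ren r U) (ren r U') (P r w')"
    "\<And>r w' u u'. ext r w' w \<Longrightarrow> (a = Rel \<longrightarrow> P r w' u u') \<Longrightarrow>
        LR n w' (clo r u F) (clo r u' F') (Q r w' u u')"
    "R = pitm a w P Q"
  using assms(1)
proof (cases rule: LR_cases)
  case (pi b V q q' G V' G' P Q)
  then have "b = a \<and> V = U \<and> q = s \<and> q' = s' \<and> G = F"
    using eval_det[OF assms(2)] by blast
  then show ?thesis using pi that[of V' G' P Q] by blast
qed (use assms(2) in \<open>auto dest!: eval_det[OF assms(2)] simp: netm_def\<close>)

text \<open>The left type alone fixes \<open>R\<close>: its weak head normal form selects the clause
  and, at function types, determines the families. These agree on extensions and related arguments,
  which is all that \<open>pitm\<close> inspects.\<close>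

lemma LR_det: "LR n w T T' R \<Longrightarrow> LR m w T T'' R' \<Longrightarrow> R = R'"
proof (induction arbitrary: m T'' R' rule: LR_induct)
  case (sort n w T T' j)
  then show ?case by (auto dest: LR_sort_inv)
next
  case (ne n w T T')
  then show ?case by (auto simp: netm_def dest: LR_ne_inv)
next
  case (pi n w T T' a U s s' F U' F' P Q)
  from pi.prems pi.hyps(2) obtain U'' F'' P' Q' where *: "T'' \<searrow> Pi a U'' s s' F''"
    "\<And>r w'. ext r w' w \<Longrightarrow> LR m w' (ren r U) (ren r U'') (P' r w')"
    "\<And>r w' u u'. ext r w' w \<Longrightarrow> (a = Rel \<longrightarrow> P' r w' u u') \<Longrightarrow>
        LR m w' (clo r u F) (clo r u' F'') (Q' r w' u u')"
    "R' = pitm a w P' Q'" by (rule LR_pi_inv) blast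
  have P: "P r w' = P' r w'" if "ext r w' w" for r w'
    using pi.IH(1)[OF that] *(2)[OF that] by blast
  have Q: "Q r w' u u' = Q' r w' u u'" if "ext r w' w" "a = Rel \<longrightarrow> P r w' u u'" for r w' u u'
    using pi.IH(2)[OF that] *(3)[OF that(1), of u u'] that(2) P[OF that(1)] by simp
  show ?case
    unfolding *(4) by (intro ext) (auto simp: pitm_def P Q)
qed

definition per :: "(expr \<Rightarrow> expr \<Rightarrow> bool) \<Rightarrow> bool" where
  "per R \<longleftrightarrow> (\<forall>t t'. R t t' \<longrightarrow> R t' t) \<and> (\<forall>t t' t''. R t t' \<longrightarrow> R t' t'' \<longrightarrow> R t t'')"

lemma netm_sym: "netm w t t' \<Longrightarrow> netm w t' t"
  unfolding netm_def using neeq_sym by blast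

lemma netm_trans: "netm w t t' \<Longrightarrow> netm w t' t'' \<Longrightarrow> w \<noteq> {} \<Longrightarrow> netm w t t''"
  unfolding netm_def using neeq_trans eval_det by blast

text \<open>The properties are proved together: at function types, symmetry and transitivity of the
  codomain relation need those of the arguments, and types and terms coincide at sorts. Arbitrary
  \<open>m\<close> and \<open>R'\<close> spare any alignment of levels.\<close>

lemma LR_equivalence:
  "LR n w T T' R \<Longrightarrow> per R \<and> LR n w T' T R \<and> (\<forall>m T'' R'. LR m w T' T'' R' \<longrightarrow> LR n w T T'' R)"
proof (induction rule: LR_induct)
  case (sort n w T T' j)
  have "per (\<lambda>t t'. \<exists>R. LR j w t t' R)"
    unfolding per_def
  proof (intro conjI allI impI; elim exE)
    show "\<exists>R. LR j w t' t R" if "LR j w t t' R" for t t' R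
      using sort.IH[OF that] by blast
    show "\<exists>R. LR j w t t'' R" if "LR j w t t' R" "LR j w t' t'' R'" for t t' t'' R R'
      using sort.IH[OF that(1)] that(2) by blast
  qed
  moreover have "LR n w T' T (\<lambda>t t'. \<exists>R. LR j w t t' R)"
    by (rule LR_sort[OF sort.hyps(1,3,2,4)])
  moreover have "LR n w T T'' (\<lambda>t t'. \<exists>R. LR j w t t' R)" if "LR m w T' T'' R'" for m T'' R'
    using LR_sort[OF sort.hyps(1,2) _ sort.hyps(4)] LR_sort_inv[OF that sort.hyps(3)] by blast
  ultimately show ?case by blast
next
  case (ne n w T T')
  have "per (netm w)" unfolding per_def using netm_sym netm_trans ne by blast
  moreover have "LR n w T' T (netm w)" by (rule LR_ne[OF ne(1) netm_sym[OF ne(2)]])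
  moreover have "LR n w T T'' (netm w)" if "LR m w T' T'' R'" for m T'' R'
  proof -
    obtain N where "T' \<searrow> N" "neutral N" using ne unfolding netm_def by blast
    then have "netm w T' T''" using LR_ne_inv[OF that] by blast
    from LR_ne[OF ne(1) netm_trans[OF ne(2) this ne(1)]] show ?thesis .
  qed
  ultimately show ?case by blast
next
  case (pi n w T T' a U s s' F U' F' P Q)
  \<comment> \<open>\<open>C\<close> describes admissible arguments; it is a partial equivalence by
    the induction hypothesis for the domain.\<close>
  define C where "C = (\<lambda>r w' u u'. ext r w' w \<and> (a = Rel \<longrightarrow> P r w' u u'))"
  have Cext: "C r w' u u' \<Longrightarrow> ext r w' w" for r w' u u' unfolding C_def by blast
  have Csym: "C r w' u' u" if "C r w' u u'" for r w' u u'
    using that pi.IH(1)[of r w'] unfolding C_def per_def by blast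
  have Ctrans: "C r w' u u''" if "C r w' u u'" "C r w' u' u''" for r w' u u' u''
    using that pi.IH(1)[of r w'] unfolding C_def per_def by blast
  have hQ: "LR n w' (clo r u F) (clo r u' F') (Q r w' u u')" if "C r w' u u'" for r w' u u'
    using that pi.hyps(5) unfolding C_def by blast
  have IHQ: "per (Q r w' u u')" "LR n w' (clo r u' F') (clo r u F) (Q r w' u u')"
    "\<And>m T'' R'. LR m w' (clo r u' F') T'' R' \<Longrightarrow> LR n w' (clo r u F) T'' (Q r w' u u')"
    if "C r w' u u'" for r w' u u'
    using that pi.IH(2)[of r w' u u'] unfolding C_def by blast+
  have Qleft: "Q r w' u u' = Q r w' u u''" if "C r w' u u'" "C r w' u u''" for r w' u u' u''
    using LR_det[OF hQ[OF that(1)] hQ[OF that(2)]] .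
  have Qright: "Q r w' u u' = Q r w' u'' u'" if "C r w' u u'" "C r w' u'' u'" for r w' u u' u''
    using LR_det[OF IHQ(2)[OF that(1)] IHQ(2)[OF that(2)]] .
  \<comment> \<open>The index moves from \<open>u u'\<close> to \<open>u u\<close> by
    \<open>Qleft\<close> and on to \<open>u' u\<close> by \<open>Qright\<close>.\<close>
  have Qsym: "Q r w' u u' = Q r w' u' u" if "C r w' u u'" for r w' u u'
    using Qleft Qright Csym Ctrans that by metis
  have pitm_C: "pitm a w P Q t t' \<longleftrightarrow>
    (\<forall>r w' u u'. C r w' u u' \<longrightarrow> Q r w' u u' (App a (ren r t) u) (App a (ren r t') u'))" for t t'
    unfolding pitm_def C_def by blast
  have "per (pitm a w P Q)"
    unfolding per_def pitm_C
  proof (intro conjI allI impI)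
    fix t t' r w' u u'
    assume *: "\<forall>r w' u u'. C r w' u u' \<longrightarrow> Q r w' u u' (App a (ren r t) u) (App a (ren r t') u')"
      and c: "C r w' u u'"
    from * Csym[OF c] have "Q r w' u' u (App a (ren r t) u') (App a (ren r t') u)" by blast
    then show "Q r w' u u' (App a (ren r t') u) (App a (ren r t) u')"
      using Qsym[OF c] IHQ(1)[OF c] unfolding per_def by metis
  next
    fix t t' t'' r w' u u'
    assume *: "\<forall>r w' u u'. C r w' u u' \<longrightarrow> Q r w' u u' (App a (ren r t) u) (App a (ren r t') u')"
      and **: "\<forall>r w' u u'. C r w' u u' \<longrightarrow> Q r w' u u' (App a (ren r t') u) (App a (ren r t'') u')"
      and c: "C r w' u u'"
    \<comment> \<open>Transitivity passes through the middle term applied to \<open>u\<close>, so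
      the first function is used on the diagonal.\<close>
    have cc: "C r w' u u" using c Csym Ctrans by blast
    have "Q r w' u u' (App a (ren r t) u) (App a (ren r t') u)"
      using * cc Qleft[OF cc c] by metis
    then show "Q r w' u u' (App a (ren r t) u) (App a (ren r t'') u')"
      using ** c IHQ(1)[OF c] unfolding per_def by metis
  qed
  moreover have "LR n w T' T (pitm a w P Q)"
  proof (rule LR_pi[OF pi.hyps(1,3,2)])
    show "LR n w' (ren r U') (ren r U) (P r w')" if "ext r w' w" for r w'
      using pi.IH(1)[OF that] by blast
    show "LR n w' (clo r u F') (clo r u' F) (Q r w' u u')"
      if "ext r w' w" "a = Rel \<longrightarrow> P r w' u u'" for r w' u u'
    proof -
      have c: "C r w' u u'" using that by (auto simp: C_def)
      show ?thesis using IHQ(2)[OF Csym[OF c]] Qsym[OF c] by simp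
    qed
  qed
  moreover have "LR n w T T'' (pitm a w P Q)" if T'': "LR m w T' T'' R'" for m T'' R'
  proof -
    from T'' pi.hyps(3) obtain U'' F'' P' Q' where *: "T'' \<searrow> Pi a U'' s s' F''"
      "\<And>r w'. ext r w' w \<Longrightarrow> LR m w' (ren r U') (ren r U'') (P' r w')"
      "\<And>r w' u u'. ext r w' w \<Longrightarrow> (a = Rel \<longrightarrow> P' r w' u u') \<Longrightarrow>
        LR m w' (clo r u F') (clo r u' F'') (Q' r w' u u')"
      by (rule LR_pi_inv) blast
    have P: "P r w' = P' r w'" if "ext r w' w" for r w'
      using pi.IH(1)[OF that] *(2)[OF that] LR_det by blast
    show ?thesis
    proof (rule LR_pi[OF pi.hyps(1,2) *(1)])
      show "LR n w' (ren r U) (ren r U'') (P r w')" if "ext r w' w" for r w'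
        using pi.IH(1)[OF that] *(2)[OF that] by blast
      show "LR n w' (clo r u F) (clo r u' F'') (Q r w' u u')"
        if "ext r w' w" "a = Rel \<longrightarrow> P r w' u u'" for r w' u u'
      proof -
        have c: "C r w' u u'" using that by (auto simp: C_def)
        \<comment> \<open>The codomains are composed as \<open>F\<close> at \<open>u\<close> with
          \<open>F'\<close> at \<open>u\<close>, then \<open>F'\<close> at \<open>u\<close> with
          \<open>F''\<close> at \<open>u'\<close>.\<close>
        have cc: "C r w' u u" using c Csym Ctrans by blast
        have "LR m w' (clo r u F') (clo r u' F'') (Q' r w' u u')"
          using *(3)[OF that(1), of u u'] that(2) P[OF that(1)] by simp
        from IHQ(3)[OF cc this] show ?thesis using Qleft[OF cc c] by simp
      qed
    qed
  qed
  ultimately show ?case by blast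
qed

section \<open>Monotonicity and head expansion\<close>

lemma LR_mono: "LR n w T T' R \<Longrightarrow> n \<le> m \<Longrightarrow> LR m w T T' R"
proof (induction rule: LR_induct)
  case sort
  then show ?case by (auto intro: LR_sort)
next
  case ne
  then show ?case by (auto intro: LR_ne)
next
  case (pi n w T T' a U s s' F U' F' P Q)
  show ?case by (rule LR_pi[OF pi.hyps(1-3)]) (use pi.IH pi.prems in blast)+
qed

text \<open>At function types the new families are the old ones precomposed with \<open>r\<close>:
  the clause already quantifies over extensions, and these compose.\<close>

lemma LR_ren:
  "LR n w T T' R \<Longrightarrow> ext r w' w \<Longrightarrow>
    \<exists>R'. LR n w' (ren r T) (ren r T') R' \<and> (\<forall>t t'. R t t' \<longrightarrow> R' (ren r t) (ren r t'))"
proof (induction arbitrary: r w' rule: LR_induct)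
  case (sort n w T T' j)
  have "LR n w' (ren r T) (ren r T') (\<lambda>t t'. \<exists>R. LR j w' t t' R)"
    using sort.hyps sort.prems ext_nonempty eval_ren[of _ "Srt (SetS j)" r] by (intro LR_sort) auto
  then show ?case using sort.IH sort.prems by blast
next
  case (ne n w T T')
  have *: "netm w t t' \<Longrightarrow> netm w' (ren r t) (ren r t')" for t t'
    unfolding netm_def using ne.prems by (meson eval_ren neeq_ren neutral_ren)
  show ?case using LR_ne[OF ext_nonempty[OF ne.prems] *[OF ne.hyps(2)]] * by blast
next
  case (pi n w T T' a U s s' F U' F' P Q)
  let ?P = "\<lambda>q w''. P (\<lambda>x. q (r x)) w''" and ?Q = "\<lambda>q w''. Q (\<lambda>x. q (r x)) w''"
  have "LR n w' (ren r T) (ren r T') (pitm a w' ?P ?Q)"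
  proof (rule LR_pi[OF ext_nonempty[OF pi.prems] eval_ren[OF pi.hyps(2), unfolded ren.simps]
          eval_ren[OF pi.hyps(3), unfolded ren.simps]])
    show "LR n w'' (ren q (ren r U)) (ren q (ren r U')) (?P q w'')" if "ext q w'' w'" for q w''
      unfolding ren_ren by (rule pi.hyps(4)[OF ext_comp[OF that pi.prems]])
    show "LR n w'' (clo q u (ren (up_ren r) F)) (clo q u' (ren (up_ren r) F')) (?Q q w'' u u')"
      if "ext q w'' w'" "a = Rel \<longrightarrow> ?P q w'' u u'" for q w'' u u'
      unfolding clo_ren_up by (rule pi.hyps(5)[OF ext_comp[OF that(1) pi.prems] that(2)])
  qed
  moreover have "pitm a w P Q t t' \<Longrightarrow> pitm a w' ?P ?Q (ren r t) (ren r t')" for t t'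
    unfolding pitm_def ren_ren using pi.prems ext_comp by blast
  ultimately show ?case by blast
qed

lemma LR_whred_left:
  assumes "LR n w T T' R" "U \<leadsto> T"
  shows "LR n w U T' R"
  using assms(1)
proof (cases rule: LR_cases)
  case sort
  then show ?thesis using assms(2) by (auto intro: LR_sort whred_eval)
next
  case ne
  then have "netm w U T'" using whred_eval[OF assms(2)] unfolding netm_def by blast
  then show ?thesis unfolding ne(3) by (rule LR_ne[OF ne(1)])
next
  case (pi a V s s' F U' F' P Q)
  show ?thesis unfolding pi(6)
    by (rule LR_pi[OF pi(1) whred_eval[OF assms(2) pi(2)] pi(3)]) (rule pi(4,5), assumption+)+
qed

text \<open>At a sort the terms are types and \<open>LR_whred_left\<close> applies; at a function
  type the step moves under the application.\<close>

lemma LR_whred_tm: "LR n w T T' R \<Longrightarrow> R t t' \<Longrightarrow> u \<leadsto> t \<Longrightarrow> R u t'"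
proof (induction arbitrary: t t' u rule: LR_induct)
  case sort
  then show ?case by (auto intro: LR_whred_left)
next
  case ne
  then show ?case by (auto simp: netm_def intro: whred_eval)
next
  case (pi n w T T' a U s s' F U' F' P Q)
  show ?case
    unfolding pitm_def
  proof (intro allI impI)
    fix r w' v v' assume *: "ext r w' w" "a = Rel \<longrightarrow> P r w' v v'"
    then have "Q r w' v v' (App a (ren r t) v) (App a (ren r t') v')"
      using pi.prems(1) unfolding pitm_def by blast
    then show "Q r w' v v' (App a (ren r u) v) (App a (ren r t') v')"
      using pi.IH(2) * pi.prems(2) by (blast intro: whred_app whred_ren)
  qed
qed

section \<open>Semantic equality without levels\<close>

definition teq :: "ctx set \<Rightarrow> expr \<Rightarrow> expr \<Rightarrow> bool" where
  "teq w T T' \<longleftrightarrow> (\<exists>n R. LR n w T T' R)"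

text \<open>By \<open>LR_det\<close> all choices of level and relation agree, so the existential
  quantifier denotes one relation, see \<open>tmeq_LR\<close>.\<close>

definition tmeq :: "ctx set \<Rightarrow> expr \<Rightarrow> expr \<Rightarrow> expr \<Rightarrow> expr \<Rightarrow> bool" where
  "tmeq w T T' t t' \<longleftrightarrow> (\<exists>n R. LR n w T T' R \<and> R t t')"

lemma tmeq_LR:
  assumes "LR n w T T' R"
  shows "tmeq w T T' = R"
proof (intro HOL.ext iffI)
  fix t t' assume "tmeq w T T' t t'"
  then obtain m R' where "LR m w T T' R'" "R' t t'" unfolding tmeq_def by blast
  then show "R t t'" using LR_det[OF assms] by blast
next
  show "tmeq w T T' t t'" if "R t t'" for t t'
    using assms that unfolding tmeq_def by blast
qed

lemma LR_tmeq: "LR n w T T' R \<Longrightarrow> LR n w T T' (tmeq w T T')"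
  by (frule tmeq_LR) simp

lemma LR_teq: "LR n w T T' R \<Longrightarrow> teq w T T'"
  unfolding teq_def by blast

lemma tmeq_teq: "tmeq w T T' t t' \<Longrightarrow> teq w T T'"
  unfolding tmeq_def teq_def by blast

lemma teqE:
  assumes "teq w T T'"
  obtains n where "LR n w T T' (tmeq w T T')"
proof -
  obtain n R where "LR n w T T' R" using assms unfolding teq_def by blast
  then show ?thesis using that[of n] tmeq_LR[of n w T T' R] by simp
qed

lemma teq_sym: "teq w T T' \<Longrightarrow> teq w T' T"
  unfolding teq_def using LR_equivalence by blast

lemma teq_trans: "teq w T T' \<Longrightarrow> teq w T' T'' \<Longrightarrow> teq w T T''"
  unfolding teq_def using LR_equivalence by blast

lemma teq_ren: "teq w T T' \<Longrightarrow> ext r w' w \<Longrightarrow> teq w' (ren r T) (ren r T')"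
  unfolding teq_def using LR_ren by blast

text \<open>Together with \<open>tmeq_swap\<close> and \<open>tmeq_right\<close> this is conversion
  in the model: one endpoint already determines the relation.\<close>

lemma tmeq_left: "teq w T T' \<Longrightarrow> teq w T T'' \<Longrightarrow> tmeq w T T' = tmeq w T T''"
  by (elim teqE) (rule LR_det)

lemma tmeq_swap: "teq w T T' \<Longrightarrow> tmeq w T T' = tmeq w T' T"
  by (elim teqE) (rule sym, rule tmeq_LR, drule LR_equivalence, blast)

lemma tmeq_right:
  assumes "teq w T T'" "teq w T'' T'"
  shows "tmeq w T T' = tmeq w T'' T'"
  unfolding tmeq_swap[OF assms(1)] tmeq_swap[OF assms(2)]
  by (rule tmeq_left[OF teq_sym teq_sym]) fact+

lemma tmeq_per: "teq w T T' \<Longrightarrow> per (tmeq w T T')"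
  by (elim teqE) (drule LR_equivalence, blast)

lemma tmeq_sym:
  assumes "tmeq w T T' t t'"
  shows "tmeq w T' T t' t"
proof -
  have "tmeq w T T' t' t"
    using assms tmeq_per[OF tmeq_teq[OF assms]] unfolding per_def by blast
  then show ?thesis unfolding tmeq_swap[OF tmeq_teq[OF assms]] .
qed

lemma tmeq_trans:
  assumes "tmeq w T T' t t'" "tmeq w T' T'' t' t''"
  shows "tmeq w T T'' t t''"
proof -
  have T: "teq w T T'" "teq w T' T''" "teq w T T''"
    using assms tmeq_teq teq_trans by blast+
  have "tmeq w T T'' t t'" "tmeq w T T'' t' t''"
    using assms unfolding tmeq_left[OF T(1,3)] tmeq_right[OF T(2,3)] .
  then show ?thesis using tmeq_per[OF T(3)] unfolding per_def by blast
qed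

lemma tmeq_ren:
  assumes "tmeq w T T' t t'" "ext r w' w"
  shows "tmeq w' (ren r T) (ren r T') (ren r t) (ren r t')"
proof -
  obtain n R where "LR n w T T' R" "R t t'" using assms(1) unfolding tmeq_def by blast
  then show ?thesis using LR_ren[OF _ assms(2)] unfolding tmeq_def by blast
qed

lemma tmeq_whred_left: "tmeq w T T' t t' \<Longrightarrow> u \<leadsto> t \<Longrightarrow> tmeq w T T' u t'"
  unfolding tmeq_def using LR_whred_tm by blast

lemma tmeq_whred_right: "tmeq w T T' t t' \<Longrightarrow> u \<leadsto> t' \<Longrightarrow> tmeq w T T' t u"
  using tmeq_whred_left tmeq_sym by blast

text \<open>Unlike \<open>teq\<close>, equality at a sort retains the level, from which
  \<open>valid_pi_LR\<close> obtains the bound \<open>max i j\<close>.\<close>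

lemma tmeq_sort: "tmeq w (Srt (SetS j)) (Srt (SetS j)) T T' \<longleftrightarrow> (\<exists>R. LR j w T T' R)"
proof -
  have "LR (Suc j) w (Srt (SetS j)) (Srt (SetS j)) (\<lambda>t t'. \<exists>R. LR j w t t' R)" if "w \<noteq> {}"
    by (rule LR_sort[OF that]) (simp_all add: ev_whnf)
  from tmeq_LR[OF this] show ?thesis
    using LR_nonempty tmeq_teq unfolding teq_def by metis
qed

abbreviation pieq :: "ann \<Rightarrow> ctx set \<Rightarrow> expr \<Rightarrow> expr \<Rightarrow> expr \<Rightarrow> expr \<Rightarrow> expr \<Rightarrow> expr \<Rightarrow> bool" where
  "pieq a w U U' F F' \<equiv> pitm a w (\<lambda>r w'. tmeq w' (ren r U) (ren r U'))
     (\<lambda>r w' u u'. tmeq w' (clo r u F) (clo r u' F'))"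

text \<open>Replaces the unknown families of \<open>LR_pi_inv\<close> by canonical ones; they
  coincide wherever \<open>pitm\<close> inspects them.\<close>

lemma LR_pi_tmeq_inv:
  assumes "LR n w T T' R" "T \<searrow> Pi a U s s' F"
  obtains U' F' where "T' \<searrow> Pi a U' s s' F'"
    "\<And>r w'. ext r w' w \<Longrightarrow> LR n w' (ren r U) (ren r U') (tmeq w' (ren r U) (ren r U'))"
    "\<And>r w' u u'. ext r w' w \<Longrightarrow> (a = Rel \<longrightarrow> tmeq w' (ren r U) (ren r U') u u') \<Longrightarrow>
        LR n w' (clo r u F) (clo r u' F') (tmeq w' (clo r u F) (clo r u' F'))"
    "R = pieq a w U U' F F'"
proof -
  from assms obtain U' F' P Q where *: "T' \<searrow> Pi a U' s s' F'"
    "\<And>r w'. ext r w' w \<Longrightarrow> LR n w' (ren r U) (ren r U') (P r w')"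
    "\<And>r w' u u'. ext r w' w \<Longrightarrow> (a = Rel \<longrightarrow> P r w' u u') \<Longrightarrow>
        LR n w' (clo r u F) (clo r u' F') (Q r w' u u')"
    "R = pitm a w P Q" by (rule LR_pi_inv) blast
  have P: "tmeq w' (ren r U) (ren r U') = P r w'" if "ext r w' w" for r w'
    using *(2)[OF that] by (rule tmeq_LR)
  have Q: "tmeq w' (clo r u F) (clo r u' F') = Q r w' u u'"
    if "ext r w' w" "a = Rel \<longrightarrow> P r w' u u'" for r w' u u'
    using *(3)[OF that] by (rule tmeq_LR)
  have R: "R = pieq a w U U' F F'"
    unfolding *(4) by (intro HOL.ext) (auto simp: pitm_def P Q)
  show ?thesis
    by (rule that[OF *(1) _ _ R]) (simp_all add: P Q *(2,3))
qed

section \<open>Reification and reflection\<close>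

definition wtynf :: "ctx set \<Rightarrow> expr \<Rightarrow> expr \<Rightarrow> bool" where
  "wtynf w T T' \<longleftrightarrow> (\<exists>V. \<forall>\<Delta>\<in>w. tynf \<Delta> T V \<and> tynf \<Delta> T' V)"

text \<open>Quantifying over \<open>S\<close> is essential for arguments: a neutral function
  synthesises its own domain, which is only semantically equal to the expected one.\<close>

definition wtmnf :: "ctx set \<Rightarrow> expr \<Rightarrow> expr \<Rightarrow> nf \<Rightarrow> bool" where
  "wtmnf w t T v \<longleftrightarrow> (\<forall>\<Delta>\<in>w. \<forall>S. teq w S T \<longrightarrow> tmnf \<Delta> t S v)"

definition wnety :: "ctx set \<Rightarrow> expr \<Rightarrow> nf \<Rightarrow> expr \<Rightarrow> bool" where
  "wnety w n m T \<longleftrightarrow> neutral n \<and> (\<forall>\<Delta>\<in>w. \<exists>S. nenf \<Delta> n m S \<and> teq w S T)"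

lemma wnety_neeq: "wnety w n m T \<Longrightarrow> wnety w n' m T \<Longrightarrow> netm w n n'"
  unfolding wnety_def netm_def neeq_def wnenf_def by (meson ev_whnf neutral_whnf)

text \<open>Injectivity of function types holds in the model by construction; \<open>S\<close> is
  first turned to the right-hand side.\<close>

lemma teq_pi_inv:
  assumes "teq w S T" "T \<searrow> Pi a U s s' F"
  obtains U' F' where "S \<searrow> Pi a U' s s' F'"
    "\<And>r w'. ext r w' w \<Longrightarrow> teq w' (ren r U) (ren r U')"
    "\<And>r w' u u'. ext r w' w \<Longrightarrow> (a = Rel \<longrightarrow> tmeq w' (ren r U) (ren r U') u u') \<Longrightarrow>
        teq w' (clo r u F) (clo r u' F')"
proof -
  obtain n R where "LR n w T S R" using teq_sym[OF assms(1)] unfolding teq_def by blast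
  from this assms(2) obtain U' F' where *: "S \<searrow> Pi a U' s s' F'"
    "\<And>r w'. ext r w' w \<Longrightarrow> LR n w' (ren r U) (ren r U') (tmeq w' (ren r U) (ren r U'))"
    "\<And>r w' u u'. ext r w' w \<Longrightarrow> (a = Rel \<longrightarrow> tmeq w' (ren r U) (ren r U') u u') \<Longrightarrow>
        LR n w' (clo r u F) (clo r u' F') (tmeq w' (clo r u F) (clo r u' F'))"
    by (rule LR_pi_tmeq_inv) blast
  show ?thesis
    by (rule that[OF *(1)]) (rule LR_teq, rule *(2,3), assumption+)+
qed

lemma wnety_app:
  assumes n: "wnety w n m T" and T: "T \<searrow> Pi a U s s' F" and r: "ext r w' w"
    and u: "a = Rel \<longrightarrow> (\<exists>X. tmeq w' (ren r U) X u u')"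
    and v: "a = Rel \<longrightarrow> wtmnf w' u' (ren r U) v"
  shows "wnety w' (App a (ren r n) u')
    (if a = Rel then NAppRel (nf_ren r m) v else NAppIrr (nf_ren r m)) (clo r u F)"
  unfolding wnety_def
proof (intro conjI ballI)
  show "neutral (App a (ren r n) u')" using n unfolding wnety_def by simp
next
  fix \<Delta>' assume "\<Delta>' \<in> w'"
  then obtain \<Delta> where \<Delta>: "\<Delta> \<in> w" "tren r \<Delta>' \<Delta>" using r unfolding ext_def by blast
  then obtain S where S: "nenf \<Delta> n m S" "teq w S T" using n unfolding wnety_def by blast
  from S(2) T obtain US FS where S': "S \<searrow> Pi a US s s' FS"
    "\<And>r w'. ext r w' w \<Longrightarrow> teq w' (ren r U) (ren r US)"
    "\<And>r w' u u'. ext r w' w \<Longrightarrow> (a = Rel \<longrightarrow> tmeq w' (ren r U) (ren r US) u u') \<Longrightarrow>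
        teq w' (clo r u F) (clo r u' FS)" by (rule teq_pi_inv) blast
  have ne: "nenf \<Delta>' (ren r n) (nf_ren r m) (ren r S)"
    using nf_judgements_ren(2)[OF S(1) \<Delta>(2)] .
  have ev: "ren r S \<searrow> Pi a (ren r US) s s' (ren (up_ren r) FS)"
    using eval_ren[OF S'(1)] by simp
  have "a = Rel \<longrightarrow> tmeq w' (ren r U) (ren r US) u u'"
    using u tmeq_left[OF S'(2)[OF r] tmeq_teq] by auto
  from teq_sym[OF S'(3)[OF r this]] have ty: "teq w' (clo r u' FS) (clo r u F)" .
  have "a = Rel \<longrightarrow> tmnf \<Delta>' u' (ren r US) v"
    using v \<open>\<Delta>' \<in> w'\<close> teq_sym[OF S'(2)[OF r]] unfolding wtmnf_def by blast
  then have "nenf \<Delta>' (App a (ren r n) u')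
    (if a = Rel then NAppRel (nf_ren r m) v else NAppIrr (nf_ren r m)) (inst u' (ren (up_ren r) FS))"
    using ne ev by (cases a) (auto intro: nenf_app_rel nenf_app_irr)
  then show "\<exists>S. nenf \<Delta>' (App a (ren r n) u')
    (if a = Rel then NAppRel (nf_ren r m) v else NAppIrr (nf_ren r m)) S \<and> teq w' S (clo r u F)"
    unfolding inst_ren_up using ty by blast
qed

text \<open>
  Extending a world by all types equal to \<open>U\<close>, not just by \<open>U\<close>, makes one normal form serve every
  representative of the type at once.
\<close>

definition wcons :: "ann \<Rightarrow> expr \<Rightarrow> ctx set \<Rightarrow> ctx set" where
  "wcons a U w = {(a, U') # \<Delta> | U' \<Delta>. teq w U' U \<and> \<Delta> \<in> w}"

lemma ext_wcons: "w \<noteq> {} \<Longrightarrow> teq w U U \<Longrightarrow> ext Suc (wcons a U w) w"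
  unfolding ext_def wcons_def using tren_Suc by blast

lemma wnety_var: "w \<noteq> {} \<Longrightarrow> teq w U U \<Longrightarrow> wnety (wcons Rel U w) (Var 0) (NVar 0) (weak U)"
proof -
  assume *: "w \<noteq> {}" "teq w U U"
  have "nenf ((Rel, U') # \<Delta>) (Var 0) (NVar 0) (weak U')" for U' \<Delta>
    by (simp add: nenf_var lookup_0)
  then show ?thesis
    using teq_ren[OF _ ext_wcons[OF *]] unfolding wnety_def wcons_def by force
qed

text \<open>Types and related terms are read back to common normal forms, and neutral terms with a
  common normal form are related. Reading back a function needs the fresh variable in the relation
  at the domain; relating neutral functions needs normal forms of their arguments.\<close>

lemma LR_reify_reflect:
  "LR n w T T' R \<Longrightarrow> wtynf w T T' \<and>
    (\<forall>t t'. R t t' \<longrightarrow> (\<exists>v. wtmnf w t T v \<and> wtmnf w t' T v)) \<and>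
    (\<forall>n n' m. wnety w n m T \<longrightarrow> wnety w n' m T \<longrightarrow> R n n')"
proof (induction rule: LR_induct)
  case (sort n w T T' j)
  have S: "S \<searrow> Srt (SetS j)" if "teq w S T" for S
    using teq_sym[OF that] LR_sort_inv[OF _ sort.hyps(2)] unfolding teq_def by blast
  have "wtynf w T T'"
    unfolding wtynf_def using tynf_sort[OF sort.hyps(2)] tynf_sort[OF sort.hyps(3)] by blast
  moreover have "\<exists>v. wtmnf w t T v \<and> wtmnf w t' T v" if *: "LR j w t t' R" for t t' R
  proof -
    obtain V where "\<forall>\<Delta>\<in>w. tynf \<Delta> t V \<and> tynf \<Delta> t' V"
      using sort.IH[OF *] unfolding wtynf_def by blast
    then have "wtmnf w t T (NTy V) \<and> wtmnf w t' T (NTy V)"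
      unfolding wtmnf_def using tmnf_sort[OF S] by blast
    then show ?thesis by blast
  qed
  \<comment> \<open>A neutral inhabitant of a universe is itself a type, handled by the neutral
    clause.\<close>
  moreover have "\<exists>R. LR j w n n' R" if "wnety w n m T" "wnety w n' m T" for n n' m
    by (rule exI, rule LR_ne[OF sort.hyps(1) wnety_neeq[OF that]])
  ultimately show ?case by blast
next
  case (ne n w T T')
  obtain N where N: "T \<searrow> N" "neutral N" using ne(2) unfolding netm_def by blast
  have S: "\<exists>N'. S \<searrow> N' \<and> neutral N'" if "teq w S T" for S
    using teq_sym[OF that] LR_ne_inv[OF _ N] unfolding teq_def netm_def by blast
  have "wtynf w T T'"
    using ne(2) unfolding wtynf_def netm_def neeq_def wnenf_def by (meson tynf_ne)
  moreover have "\<exists>v. wtmnf w t T v \<and> wtmnf w t' T v" if "netm w t t'" for t t'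
  proof -
    from that obtain k k' m where "t \<searrow> k" "t' \<searrow> k'" "neutral k" "neutral k'"
      "wnenf w k m" "wnenf w k' m" unfolding netm_def neeq_def by blast
    then have "wtmnf w t T (NNe m) \<and> wtmnf w t' T (NNe m)"
      unfolding wtmnf_def wnenf_def using S by (meson tmnf_ne)
    then show ?thesis by blast
  qed
  ultimately show ?case using wnety_neeq by blast
next
  case (pi n w T T' a U s s' F U' F' P Q)
  have UU': "LR n w U U' (P (\<lambda>x. x) w)" using pi.hyps(4)[OF ext_id[OF pi.hyps(1)]] by simp
  have U: "teq w U U" using UU' teq_sym teq_trans LR_teq by blast
  let ?w = "wcons a U w"
  have e: "ext Suc ?w w" using ext_wcons[OF pi.hyps(1) U] .
  have x: "a = Rel \<longrightarrow> P Suc ?w (Var 0) (Var 0)"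
    using pi.IH(1)[OF e] wnety_var[OF pi.hyps(1) U] by blast
  have wmem: "(a, U1) # \<Delta> \<in> ?w" if "teq w U1 U" "\<Delta> \<in> w" for U1 \<Delta>
    using that unfolding wcons_def by blast
  have P: "tmeq w' (ren r U) (ren r U') = P r w'" if "ext r w' w" for r w'
    using pi.hyps(4)[OF that] by (rule tmeq_LR)
  obtain V where V: "\<forall>\<Delta>\<in>w. tynf \<Delta> U V \<and> tynf \<Delta> U' V"
    using pi.IH(1)[OF ext_id[OF pi.hyps(1)]] unfolding wtynf_def by auto
  obtain W where W: "\<forall>\<Delta>\<in>?w. tynf \<Delta> F W \<and> tynf \<Delta> F' W"
    using pi.IH(2)[OF e x] unfolding wtynf_def clo_Suc_Var by auto
  \<comment> \<open>Both \<open>(a, U) # \<Delta>\<close> and \<open>(a, U') # \<Delta>\<close> lie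
    in \<open>?w\<close>, so the single \<open>W\<close> works for \<open>T\<close> and for
    \<open>T'\<close>.\<close>
  have "tynf \<Delta> T (NPi a V s s' W) \<and> tynf \<Delta> T' (NPi a V s s' W)" if "\<Delta> \<in> w" for \<Delta>
    using V W wmem[OF U that] wmem[OF teq_sym[OF LR_teq[OF UU']] that] that
    by (auto intro: tynf_pi[OF pi.hyps(2)] tynf_pi[OF pi.hyps(3)])
  then have "wtynf w T T'" unfolding wtynf_def by blast
  moreover have "\<exists>v. wtmnf w t T v \<and> wtmnf w t' T v" if t: "pitm a w P Q t t'" for t t'
  proof -
    have "Q Suc ?w (Var 0) (Var 0) (App a (weak t) (Var 0)) (App a (weak t') (Var 0))"
      using t e x unfolding pitm_def by blast
    then obtain v where v: "wtmnf ?w (App a (weak t) (Var 0)) F v"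
      "wtmnf ?w (App a (weak t') (Var 0)) F v"
      using pi.IH(2)[OF e x] unfolding clo_Suc_Var by blast
    have "tmnf \<Delta> t S (NLam a v) \<and> tmnf \<Delta> t' S (NLam a v)" if "\<Delta> \<in> w" "teq w S T" for \<Delta> S
    proof -
      from that(2) pi.hyps(2) obtain US FS where S: "S \<searrow> Pi a US s s' FS"
        "\<And>r w'. ext r w' w \<Longrightarrow> teq w' (ren r U) (ren r US)"
        "\<And>r w' u u'. ext r w' w \<Longrightarrow> (a = Rel \<longrightarrow> tmeq w' (ren r U) (ren r US) u u') \<Longrightarrow>
          teq w' (clo r u F) (clo r u' FS)" by (rule teq_pi_inv) blast
      \<comment> \<open>\<open>S\<close> brings its own domain \<open>US\<close>, but the context
        extended by \<open>US\<close> also lies in \<open>?w\<close>, where \<open>v\<close> was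
        found.\<close>
      have "teq w US U" using teq_sym[OF S(2)[OF ext_id[OF pi.hyps(1)]]] by simp
      then have mem: "(a, US) # \<Delta> \<in> ?w" using wmem that(1) by blast
      have "tmeq ?w (weak U) (weak U') = tmeq ?w (weak U) (weak US)"
        by (rule tmeq_left[OF LR_teq[OF pi.hyps(4)[OF e]] S(2)[OF e]])
      then have "a = Rel \<longrightarrow> tmeq ?w (weak U) (weak US) (Var 0) (Var 0)"
        using x unfolding P[OF e, symmetric] by (cases a) simp_all
      from teq_sym[OF S(3)[OF e this]] have "teq ?w FS F" unfolding clo_Suc_Var .
      then show ?thesis
        using v mem unfolding wtmnf_def by (blast intro: tmnf_pi[OF S(1)])
    qed
    then show ?thesis unfolding wtmnf_def by blast
  qed
  moreover have "pitm a w P Q k k'" if k: "wnety w k m T" "wnety w k' m T" for k k' m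
    unfolding pitm_def
  proof (intro allI impI)
    fix r w' u u' assume *: "ext r w' w" "a = Rel \<longrightarrow> P r w' u u'"
    have "teq w' (ren r U) (ren r U')" using LR_teq[OF pi.hyps(4)[OF *(1)]] .
    \<comment> \<open>Both applications must have type \<open>clo r u F\<close>; the left one
      therefore uses \<open>u\<close> related to itself.\<close>
    then have uu: "a = Rel \<longrightarrow> tmeq w' (ren r U) (ren r U') u u"
      using *(2) tmeq_per unfolding P[OF *(1), symmetric] per_def by blast
    obtain v where v: "a = Rel \<longrightarrow> wtmnf w' u (ren r U) v \<and> wtmnf w' u' (ren r U) v"
      using *(2) pi.IH(1)[OF *(1)] by blast
    have uu': "a = Rel \<longrightarrow> tmeq w' (ren r U) (ren r U') u u'"
      using *(2) unfolding P[OF *(1)] .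
    have "wnety w' (App a (ren r k) u)
        (if a = Rel then NAppRel (nf_ren r m) v else NAppIrr (nf_ren r m)) (clo r u F)"
      by (rule wnety_app[OF k(1) pi.hyps(2) *(1)]) (use uu v in blast)+
    moreover have "wnety w' (App a (ren r k') u')
        (if a = Rel then NAppRel (nf_ren r m) v else NAppIrr (nf_ren r m)) (clo r u F)"
      by (rule wnety_app[OF k(2) pi.hyps(2) *(1)]) (use uu' v in blast)+
    ultimately show "Q r w' u u' (App a (ren r k) u) (App a (ren r k') u')"
      using pi.IH(2)[OF *] by blast
  qed
  ultimately show ?case by blast
qed

section \<open>Fundamental theorem and completeness\<close>

fun sub_eq :: "ctx set \<Rightarrow> ctx \<Rightarrow> (nat \<Rightarrow> expr) \<Rightarrow> (nat \<Rightarrow> expr) \<Rightarrow> bool" where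
  "sub_eq w [] \<sigma> \<sigma>' \<longleftrightarrow> True"
| "sub_eq w ((a, U) # \<Gamma>) \<sigma> \<sigma>' \<longleftrightarrow> sub_eq w \<Gamma> (\<lambda>x. \<sigma> (Suc x)) (\<lambda>x. \<sigma>' (Suc x)) \<and>
     (a = Rel \<longrightarrow> tmeq w (sub (\<lambda>x. \<sigma> (Suc x)) U) (sub (\<lambda>x. \<sigma>' (Suc x)) U) (\<sigma> 0) (\<sigma>' 0))"

lemma sub_eq_sym: "sub_eq w \<Gamma> \<sigma> \<sigma>' \<Longrightarrow> sub_eq w \<Gamma> \<sigma>' \<sigma>"
  by (induction w \<Gamma> \<sigma> \<sigma>' rule: sub_eq.induct) (auto intro: tmeq_sym)

lemma sub_eq_trans: "sub_eq w \<Gamma> \<sigma> \<sigma>' \<Longrightarrow> sub_eq w \<Gamma> \<sigma>' \<sigma>'' \<Longrightarrow> sub_eq w \<Gamma> \<sigma> \<sigma>''"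
  by (induction w \<Gamma> \<sigma> \<sigma>' arbitrary: \<sigma>'' rule: sub_eq.induct) (auto intro: tmeq_trans)

lemma sub_eq_ren: "sub_eq w \<Gamma> \<sigma> \<sigma>' \<Longrightarrow> ext r w' w \<Longrightarrow>
    sub_eq w' \<Gamma> (\<lambda>x. ren r (\<sigma> x)) (\<lambda>x. ren r (\<sigma>' x))"
proof (induction w \<Gamma> \<sigma> \<sigma>' rule: sub_eq.induct)
  case (2 w a U \<Gamma> \<sigma> \<sigma>')
  then show ?case
    using tmeq_ren[of w "sub (\<lambda>x. \<sigma> (Suc x)) U" "sub (\<lambda>x. \<sigma>' (Suc x)) U" "\<sigma> 0" "\<sigma>' 0" r w']
    by (auto simp: ren_sub)
qed simp

lemma sub_eq_lookup:
  "sub_eq w \<Gamma> \<sigma> \<sigma>' \<Longrightarrow> lookup \<Gamma> x Rel T \<Longrightarrow> tmeq w (sub \<sigma> T) (sub \<sigma>' T) (\<sigma> x) (\<sigma>' x)"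
proof (induction w \<Gamma> \<sigma> \<sigma>' arbitrary: x T rule: sub_eq.induct)
  case (1 w \<sigma> \<sigma>')
  then show ?case by (simp add: lookup_def)
next
  case (2 w a U \<Gamma> \<sigma> \<sigma>')
  show ?case
  proof (cases x)
    case 0
    then show ?thesis using 2 by (simp add: lookup_0 sub_ren)
  next
    case (Suc y)
    then obtain T' where "lookup \<Gamma> y Rel T'" "T = weak T'" using 2 by (auto simp: lookup_Suc)
    then show ?thesis using 2 Suc by (simp add: sub_ren)
  qed
qed

text \<open>Semantic equality of the two instances of \<open>T\<close> is part of
  \<open>tmeq\<close>, so validity of the type comes along. Typing is the case where
  \<open>t\<close> and \<open>t'\<close> coincide.\<close>

definition valid :: "ctx \<Rightarrow> expr \<Rightarrow> expr \<Rightarrow> expr \<Rightarrow> bool" where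
  "valid \<Gamma> t t' T \<longleftrightarrow> (\<forall>w \<sigma> \<sigma>'. w \<noteq> {} \<longrightarrow> sub_eq w \<Gamma> \<sigma> \<sigma>' \<longrightarrow>
     tmeq w (sub \<sigma> T) (sub \<sigma>' T) (sub \<sigma> t) (sub \<sigma>' t'))"

lemma validI: "(\<And>w \<sigma> \<sigma>'. w \<noteq> {} \<Longrightarrow> sub_eq w \<Gamma> \<sigma> \<sigma>' \<Longrightarrow>
    tmeq w (sub \<sigma> T) (sub \<sigma>' T) (sub \<sigma> t) (sub \<sigma>' t')) \<Longrightarrow> valid \<Gamma> t t' T"
  unfolding valid_def by blast

lemma validD: "valid \<Gamma> t t' T \<Longrightarrow> w \<noteq> {} \<Longrightarrow> sub_eq w \<Gamma> \<sigma> \<sigma>' \<Longrightarrow>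
    tmeq w (sub \<sigma> T) (sub \<sigma>' T) (sub \<sigma> t) (sub \<sigma>' t')"
  unfolding valid_def by blast

lemma valid_sym: "valid \<Gamma> t t' T \<Longrightarrow> valid \<Gamma> t' t T"
  by (rule validI) (blast intro: tmeq_sym validD sub_eq_sym)

text \<open>One of the two judgements is instantiated on the diagonal, which is available because
  \<open>sub_eq\<close> is symmetric and transitive.\<close>

lemma valid_trans: "valid \<Gamma> t t' T \<Longrightarrow> valid \<Gamma> t' t'' T \<Longrightarrow> valid \<Gamma> t t'' T"
  by (rule validI) (meson tmeq_trans validD sub_eq_sym sub_eq_trans)

lemma valid_left: "valid \<Gamma> t t' T \<Longrightarrow> valid \<Gamma> t t T"
  by (meson valid_sym valid_trans)

lemma valid_typeD:
  assumes "valid \<Gamma> T T' (Srt (SetS j))" "w \<noteq> {}" "sub_eq w \<Gamma> \<sigma> \<sigma>'"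
  shows "\<exists>R. LR j w (sub \<sigma> T) (sub \<sigma>' T') R"
  using validD[OF assms] by (simp add: tmeq_sort)

lemma valid_teq:
  assumes "valid \<Gamma> T T' (Srt s)" "w \<noteq> {}" "sub_eq w \<Gamma> \<sigma> \<sigma>'"
  shows "teq w (sub \<sigma> T) (sub \<sigma>' T')"
proof -
  obtain j where "s = SetS j" by (cases s)
  then show ?thesis using valid_typeD assms unfolding teq_def by blast
qed

section \<open>Validity of the rules\<close>

lemma valid_var: "lookup \<Gamma> x Rel T \<Longrightarrow> valid \<Gamma> (Var x) (Var x) T"
  by (rule validI) (simp add: sub_eq_lookup)

lemma valid_sort: "valid \<Gamma> (Srt (SetS j)) (Srt (SetS j)) (Srt (SetS (Suc j)))"
proof (rule validI)
  fix w :: "ctx set" and \<sigma> \<sigma>' assume "w \<noteq> {}"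
  then have "LR (Suc j) w (Srt (SetS j)) (Srt (SetS j)) (\<lambda>t t'. \<exists>R. LR j w t t' R)"
    by (rule LR_sort) (simp_all add: ev_whnf)
  then show "tmeq w (sub \<sigma> (Srt (SetS (Suc j)))) (sub \<sigma>' (Srt (SetS (Suc j))))
      (sub \<sigma> (Srt (SetS j))) (sub \<sigma>' (Srt (SetS j)))"
    unfolding sub.simps tmeq_sort by blast
qed

lemma sub_eq_cons:
  assumes "sub_eq w \<Gamma> \<sigma> \<sigma>'" "ext r w' w"
    and "a = Rel \<longrightarrow> tmeq w' (ren r (sub \<sigma> U)) (ren r (sub \<sigma>' U)) u u'"
  shows "sub_eq w' ((a, U) # \<Gamma>) (case_nat u (\<lambda>x. ren r (\<sigma> x))) (case_nat u' (\<lambda>x. ren r (\<sigma>' x)))"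
  using assms sub_eq_ren[OF assms(1,2)] by (simp add: ren_sub)

lemma sub_eq_cons_id:
  assumes "sub_eq w \<Gamma> \<sigma> \<sigma>'"
    and "a = Rel \<longrightarrow> tmeq w (sub \<sigma> U) (sub \<sigma>' U) u u'"
  shows "sub_eq w ((a, U) # \<Gamma>) (case_nat u \<sigma>) (case_nat u' \<sigma>')"
  using assms by simp

lemma valid_pi_LR:
  assumes U: "valid \<Gamma> U U' (Srt (SetS i))" and T: "valid ((a, U) # \<Gamma>) T T' (Srt (SetS j))"
    and w: "w \<noteq> {}" "sub_eq w \<Gamma> \<sigma> \<sigma>'"
  shows "\<exists>R. LR (max i j) w (sub \<sigma> (Pi a U s s' T)) (sub \<sigma>' (Pi a U' s s' T')) R"
proof -
  let ?P = "\<lambda>r w'. tmeq w' (ren r (sub \<sigma> U)) (ren r (sub \<sigma>' U'))"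
  let ?Q = "\<lambda>r w' u u'. tmeq w' (clo r u (sub (up_sub \<sigma>) T)) (clo r u' (sub (up_sub \<sigma>') T'))"
  have UU: "\<exists>R. LR i w' (ren r (sub \<sigma> U)) (ren r (sub \<sigma>' U')) R" if "ext r w' w" for r w'
    using valid_typeD[OF U ext_nonempty[OF that] sub_eq_ren[OF w(2) that]] by (simp add: ren_sub)
  have "LR (max i j) w (Pi a (sub \<sigma> U) s s' (sub (up_sub \<sigma>) T))
      (Pi a (sub \<sigma>' U') s s' (sub (up_sub \<sigma>') T')) (pitm a w ?P ?Q)"
  proof (rule LR_pi[OF w(1) ev_whnf ev_whnf])
    show "LR (max i j) w' (ren r (sub \<sigma> U)) (ren r (sub \<sigma>' U')) (?P r w')" if e: "ext r w' w" for r w'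
    proof -
      obtain R where "LR i w' (ren r (sub \<sigma> U)) (ren r (sub \<sigma>' U')) R" using UU[OF e] by blast
      then have "LR (max i j) w' (ren r (sub \<sigma> U)) (ren r (sub \<sigma>' U')) R"
        by (rule LR_mono) simp
      then show ?thesis by (rule LR_tmeq)
    qed
    show "LR (max i j) w' (clo r u (sub (up_sub \<sigma>) T)) (clo r u' (sub (up_sub \<sigma>') T')) (?Q r w' u u')"
      if e: "ext r w' w" and u: "a = Rel \<longrightarrow> ?P r w' u u'" for r w' u u'
    proof -
      have 1: "teq w' (ren r (sub \<sigma> U)) (ren r (sub \<sigma>' U'))"
        using UU[OF e] LR_teq by blast
      \<comment> \<open>Arguments arrive related at \<open>U\<close> and \<open>U'\<close>, whereas
        the codomains are valid in the context extended by \<open>U\<close>; the relation is moved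
        to \<open>U\<close> on both sides.\<close>
      have 2: "teq w' (ren r (sub \<sigma> U)) (ren r (sub \<sigma>' U))"
        by (rule teq_ren[OF valid_teq[OF valid_left[OF U] w] e])
      have "a = Rel \<longrightarrow> tmeq w' (ren r (sub \<sigma> U)) (ren r (sub \<sigma>' U)) u u'"
        using u unfolding tmeq_left[OF 1 2] .
      from valid_typeD[OF T ext_nonempty[OF e] sub_eq_cons[OF w(2) e this]]
      obtain R where "LR j w' (clo r u (sub (up_sub \<sigma>) T)) (clo r u' (sub (up_sub \<sigma>') T')) R"
        unfolding clo_sub_up by blast
      then have "LR (max i j) w' (clo r u (sub (up_sub \<sigma>) T)) (clo r u' (sub (up_sub \<sigma>') T')) R"
        by (rule LR_mono) simp
      then show ?thesis by (rule LR_tmeq)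
    qed
  qed simp_all
  then show ?thesis by auto
qed

lemma valid_pi:
  assumes "valid \<Gamma> U U' (Srt (SetS i))" "valid ((a, U) # \<Gamma>) T T' (Srt (SetS j))"
  shows "valid \<Gamma> (Pi a U s s' T) (Pi a U' s s' T') (Srt (SetS (max i j)))"
proof (rule validI)
  fix w \<sigma> \<sigma>' assume "w \<noteq> {}" "sub_eq w \<Gamma> \<sigma> \<sigma>'"
  then show "tmeq w (sub \<sigma> (Srt (SetS (max i j)))) (sub \<sigma>' (Srt (SetS (max i j))))
      (sub \<sigma> (Pi a U s s' T)) (sub \<sigma>' (Pi a U' s s' T'))"
    using valid_pi_LR[OF assms] unfolding sub.simps(1) tmeq_sort by blast
qed

lemma
  assumes "teq w (Pi a U s s' F) (Pi a U' s s' F')"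
  shows teq_Pi_codomain: "\<And>r w' u u'. ext r w' w \<Longrightarrow>
        (a = Rel \<longrightarrow> tmeq w' (ren r U) (ren r U') u u') \<Longrightarrow> teq w' (clo r u F) (clo r u' F')"
    and tmeq_Pi: "tmeq w (Pi a U s s' F) (Pi a U' s s' F') = pieq a w U U' F F'"
proof -
  obtain n where n: "LR n w (Pi a U s s' F) (Pi a U' s s' F')
      (tmeq w (Pi a U s s' F) (Pi a U' s s' F'))"
    using assms by (rule teqE)
  have "Pi a U s s' F \<searrow> Pi a U s s' F" by (simp add: ev_whnf)
  from LR_pi_tmeq_inv[OF n this] obtain U1 F1 where *: "Pi a U' s s' F' \<searrow> Pi a U1 s s' F1"
    "\<And>r w'. ext r w' w \<Longrightarrow> LR n w' (ren r U) (ren r U1) (tmeq w' (ren r U) (ren r U1))"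
    "\<And>r w' u u'. ext r w' w \<Longrightarrow> (a = Rel \<longrightarrow> tmeq w' (ren r U) (ren r U1) u u') \<Longrightarrow>
        LR n w' (clo r u F) (clo r u' F1) (tmeq w' (clo r u F) (clo r u' F1))"
    "tmeq w (Pi a U s s' F) (Pi a U' s s' F') = pieq a w U U1 F F1"
    by blast
  have "U1 = U'" "F1 = F'" using eval_whnf_eq(1)[OF *(1)] by simp_all
  note * = *[unfolded this]
  show "teq w' (clo r u F) (clo r u' F')"
    if "ext r w' w" "a = Rel \<longrightarrow> tmeq w' (ren r U) (ren r U') u u'" for r w' u u'
    by (rule LR_teq[OF *(3)[OF that]])
  show "tmeq w (Pi a U s s' F) (Pi a U' s s' F') = pieq a w U U' F F'" by (rule *(4))
qed

lemma ren_Lam_beta: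
  "App a (ren r (sub \<sigma> (Lam a U t))) u \<leadsto> sub (case_nat u (\<lambda>x. ren r (\<sigma> x))) t"
proof -
  have "App a (ren r (sub \<sigma> (Lam a U t))) u \<leadsto> inst u (ren (up_ren r) (sub (up_sub \<sigma>) t))"
    by (simp add: whred_beta)
  then show ?thesis by (simp only: inst_ren_up clo_sub_up)
qed

text \<open>Applied to related arguments, both abstractions head-reduce to their bodies under
  extended substitutions, and the domain annotations disappear. The premise on the function type is
  semantic so that typing and congruence can share the proof.\<close>

lemma valid_lam:
  assumes Pi: "\<And>w \<sigma> \<sigma>'. w \<noteq> {} \<Longrightarrow> sub_eq w \<Gamma> \<sigma> \<sigma>' \<Longrightarrow>
      teq w (sub \<sigma> (Pi a U s s' T)) (sub \<sigma>' (Pi a U s s' T))"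
    and t: "valid ((a, U) # \<Gamma>) t t' T"
  shows "valid \<Gamma> (Lam a U t) (Lam a U' t') (Pi a U s s' T)"
proof (rule validI)
  fix w \<sigma> \<sigma>' assume w: "w \<noteq> {}" "sub_eq w \<Gamma> \<sigma> \<sigma>'"
  have P: "tmeq w (sub \<sigma> (Pi a U s s' T)) (sub \<sigma>' (Pi a U s s' T)) =
      pieq a w (sub \<sigma> U) (sub \<sigma>' U) (sub (up_sub \<sigma>) T) (sub (up_sub \<sigma>') T)"
    unfolding sub.simps by (rule tmeq_Pi[OF Pi[OF w, unfolded sub.simps]])
  show "tmeq w (sub \<sigma> (Pi a U s s' T)) (sub \<sigma>' (Pi a U s s' T)) (sub \<sigma> (Lam a U t)) (sub \<sigma>' (Lam a U' t'))"
    unfolding P unfolding pitm_def clo_sub_up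
  proof (intro allI impI)
    fix r w' u u'
    assume e: "ext r w' w" and u: "a = Rel \<longrightarrow> tmeq w' (ren r (sub \<sigma> U)) (ren r (sub \<sigma>' U)) u u'"
    show "tmeq w' (sub (case_nat u (\<lambda>x. ren r (\<sigma> x))) T) (sub (case_nat u' (\<lambda>x. ren r (\<sigma>' x))) T)
        (App a (ren r (sub \<sigma> (Lam a U t))) u) (App a (ren r (sub \<sigma>' (Lam a U' t'))) u')"
      by (rule tmeq_whred_left[OF tmeq_whred_right[OF
            validD[OF t ext_nonempty[OF e] sub_eq_cons[OF w(2) e u]] ren_Lam_beta] ren_Lam_beta])
  qed
qed

lemma valid_app:
  assumes t: "valid \<Gamma> t t' (Pi a U s s' T)" and u: "a = Rel \<longrightarrow> valid \<Gamma> u u' U"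
  shows "valid \<Gamma> (App a t u) (App a t' u') (inst u T)"
proof (rule validI)
  fix w \<sigma> \<sigma>' assume w: "w \<noteq> {}" "sub_eq w \<Gamma> \<sigma> \<sigma>'"
  let ?T = "\<lambda>\<sigma> u. sub (case_nat (sub \<sigma> u) \<sigma>) T"
  note tt = validD[OF t w]
  note cod = teq_Pi_codomain[OF tmeq_teq[OF tt, unfolded sub.simps]]
  have P: "tmeq w (sub \<sigma> (Pi a U s s' T)) (sub \<sigma>' (Pi a U s s' T)) =
      pieq a w (sub \<sigma> U) (sub \<sigma>' U) (sub (up_sub \<sigma>) T) (sub (up_sub \<sigma>') T)"
    unfolding sub.simps by (rule tmeq_Pi[OF tmeq_teq[OF tt, unfolded sub.simps]])
  have u1: "a = Rel \<longrightarrow> tmeq w (sub \<sigma> U) (sub \<sigma>' U) (sub \<sigma> u) (sub \<sigma>' u')"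
    using u validD w by blast
  have u2: "a = Rel \<longrightarrow> tmeq w (sub \<sigma> U) (sub \<sigma>' U) (sub \<sigma> u) (sub \<sigma>' u)"
    using u validD[OF valid_left] w by blast
  have T1: "teq w (?T \<sigma> u) (?T \<sigma>' u')"
    using cod[OF ext_id[OF w(1)], of "sub \<sigma> u" "sub \<sigma>' u'"] u1 by (simp add: clo_sub_up)
  \<comment> \<open>Application yields the right-hand type at \<open>u'\<close>, but the conclusion
    has \<open>inst u T\<close> on both sides; the common left endpoint allows the change.\<close>
  have T2: "teq w (?T \<sigma> u) (?T \<sigma>' u)"
    using cod[OF ext_id[OF w(1)], of "sub \<sigma> u" "sub \<sigma>' u"] u2 by (simp add: clo_sub_up)
  have "tmeq w (?T \<sigma> u) (?T \<sigma>' u') (App a (sub \<sigma> t) (sub \<sigma> u)) (App a (sub \<sigma>' t') (sub \<sigma>' u'))"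
    using tt[unfolded P pitm_def, rule_format, OF ext_id[OF w(1)], of "sub \<sigma> u" "sub \<sigma>' u'"] u1
    by (simp add: clo_sub_up)
  then show "tmeq w (sub \<sigma> (inst u T)) (sub \<sigma>' (inst u T)) (sub \<sigma> (App a t u)) (sub \<sigma>' (App a t' u'))"
    unfolding sub_inst sub.simps tmeq_left[OF T1 T2] .
qed

lemma valid_beta:
  assumes t: "valid ((a, U) # \<Gamma>) t t T" and u: "a = Rel \<longrightarrow> valid \<Gamma> u u U"
  shows "valid \<Gamma> (App a (Lam a U t) u) (inst u t) (inst u T)"
proof (rule validI)
  fix w \<sigma> \<sigma>' assume w: "w \<noteq> {}" "sub_eq w \<Gamma> \<sigma> \<sigma>'"
  have "a = Rel \<longrightarrow> tmeq w (sub \<sigma> U) (sub \<sigma>' U) (sub \<sigma> u) (sub \<sigma>' u)"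
    using u validD w by blast
  note * = validD[OF t w(1) sub_eq_cons_id[OF w(2) this]]
  have "sub \<sigma> (App a (Lam a U t) u) \<leadsto> sub (case_nat (sub \<sigma> u) \<sigma>) t"
    using ren_Lam_beta[of a "\<lambda>x. x" \<sigma> U t "sub \<sigma> u"] by simp
  from tmeq_whred_left[OF * this]
  show "tmeq w (sub \<sigma> (inst u T)) (sub \<sigma>' (inst u T)) (sub \<sigma> (App a (Lam a U t) u)) (sub \<sigma>' (inst u t))"
    unfolding sub_inst .
qed

text \<open>The relation at function types is extensional, and the expansion applied to
  \<open>u\<close> head-reduces to \<open>t\<close> applied to \<open>u\<close>.\<close>

lemma valid_eta:
  assumes t: "valid \<Gamma> t t (Pi a U s s' T)"
  shows "valid \<Gamma> t (Lam a U (App a (weak t) (Var 0))) (Pi a U s s' T)"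
proof (rule validI)
  fix w \<sigma> \<sigma>' assume w: "w \<noteq> {}" "sub_eq w \<Gamma> \<sigma> \<sigma>'"
  note tt = validD[OF t w]
  have P: "tmeq w (sub \<sigma> (Pi a U s s' T)) (sub \<sigma>' (Pi a U s s' T)) =
      pieq a w (sub \<sigma> U) (sub \<sigma>' U) (sub (up_sub \<sigma>) T) (sub (up_sub \<sigma>') T)"
    unfolding sub.simps by (rule tmeq_Pi[OF tmeq_teq[OF tt, unfolded sub.simps]])
  have red: "App a (ren r (sub \<sigma>' (Lam a U (App a (weak t) (Var 0))))) u \<leadsto> App a (ren r (sub \<sigma>' t)) u" for r u
    using ren_Lam_beta[of a r \<sigma>' U "App a (weak t) (Var 0)" u] by (simp add: sub_ren ren_sub)
  show "tmeq w (sub \<sigma> (Pi a U s s' T)) (sub \<sigma>' (Pi a U s s' T)) (sub \<sigma> t)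
      (sub \<sigma>' (Lam a U (App a (weak t) (Var 0))))"
    unfolding P unfolding pitm_def
  proof (intro allI impI)
    fix r w' u u'
    assume "ext r w' w" "a = Rel \<longrightarrow> tmeq w' (ren r (sub \<sigma> U)) (ren r (sub \<sigma>' U)) u u'"
    then have "tmeq w' (clo r u (sub (up_sub \<sigma>) T)) (clo r u' (sub (up_sub \<sigma>') T))
        (App a (ren r (sub \<sigma> t)) u) (App a (ren r (sub \<sigma>' t)) u')"
      using tt unfolding P pitm_def by blast
    then show "tmeq w' (clo r u (sub (up_sub \<sigma>) T)) (clo r u' (sub (up_sub \<sigma>') T))
        (App a (ren r (sub \<sigma> t)) u) (App a (ren r (sub \<sigma>' (Lam a U (App a (weak t) (Var 0))))) u')"
      by (rule tmeq_whred_right[OF _ red])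
  qed
qed

lemma valid_conv:
  assumes t: "valid \<Gamma> t t' T" and T: "valid \<Gamma> T T' (Srt s)"
  shows "valid \<Gamma> t t' T'"
proof (rule validI)
  fix w \<sigma> \<sigma>' assume w: "w \<noteq> {}" "sub_eq w \<Gamma> \<sigma> \<sigma>'"
  have 1: "teq w (sub \<sigma> T) (sub \<sigma>' T)" by (rule tmeq_teq[OF validD[OF t w]])
  have 2: "teq w (sub \<sigma> T) (sub \<sigma>' T')" by (rule valid_teq[OF T w])
  have 3: "teq w (sub \<sigma> T') (sub \<sigma>' T')" by (rule valid_teq[OF valid_left[OF valid_sym[OF T]] w])
  show "tmeq w (sub \<sigma> T') (sub \<sigma>' T') (sub \<sigma> t) (sub \<sigma>' t')"
    using validD[OF t w] unfolding tmeq_left[OF 1 2] tmeq_right[OF 2 3] .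
qed

lemma fundamental:
  shows "\<turnstile> \<Gamma> \<Longrightarrow> True"
    and "\<Gamma> \<turnstile> t \<Colon> T \<Longrightarrow> valid \<Gamma> t t T"
    and "\<Gamma> \<turnstile> t \<doteq> t' \<Colon> T \<Longrightarrow> valid \<Gamma> t t' T"
proof (induction rule: wf_ctx_typing_equal.inducts)
  case (ty_sort \<Gamma> s s')
  then show ?case by (auto simp: Axiom_def intro: valid_sort)
next
  case (ty_pi \<Gamma> U s1 a T s2 s3)
  then show ?case by (auto simp: Rule_def intro: valid_pi)
next
  case (ty_var \<Gamma> x U)
  then show ?case by (blast intro: valid_var)
next
  case (ty_lam a U \<Gamma> t T s s' s'')
  show ?case by (rule valid_lam[OF valid_teq[OF ty_lam.IH(2)] ty_lam.IH(1)])
next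
  case (ty_app \<Gamma> t a U s s' T u)
  then show ?case by (cases a) (auto intro: valid_app)
next
  case ty_conv
  then show ?case by (blast intro: valid_conv)
next
  case (eq_beta a U \<Gamma> t T u)
  then show ?case by (cases a) (auto intro: valid_beta)
next
  case eq_eta
  then show ?case by (blast intro: valid_eta)
next
  case eq_sym
  then show ?case by (blast intro: valid_sym)
next
  case eq_trans
  then show ?case by (blast intro: valid_trans)
next
  case (eq_pi \<Gamma> U U' s1 a T T' s2 s3)
  then show ?case by (auto simp: Rule_def intro: valid_pi)
next
  case (eq_lam \<Gamma> U U' s1 a T s2 t t')
  obtain i j where ij: "s1 = SetS i" "s2 = SetS j" by (cases s1, cases s2)
  have "valid \<Gamma> (Pi a U s1 s2 T) (Pi a U s1 s2 T) (Srt (SetS (max i j)))"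
    by (rule valid_pi) (use eq_lam.IH(1,2) valid_left in \<open>auto simp: ij\<close>)
  from valid_lam[OF valid_teq[OF this] eq_lam.IH(3)] show ?case .
next
  case eq_app_rel
  then show ?case by (blast intro: valid_app)
next
  case eq_app_irr
  then show ?case by (blast intro: valid_app)
next
  case eq_conv
  then show ?case by (blast intro: valid_conv)
qed simp_all

section \<open>The identity substitution and completeness\<close>

inductive_cases wf_ctx_consE: "\<turnstile> (a, T) # \<Gamma>"

lemma typing_wf_ctx:
  shows "\<turnstile> \<Gamma> \<Longrightarrow> True"
    and "\<Gamma> \<turnstile> t \<Colon> T \<Longrightarrow> \<turnstile> \<Gamma>"
    and "\<Gamma> \<turnstile> t \<doteq> t' \<Colon> T \<Longrightarrow> \<turnstile> \<Gamma>"
  by (induction rule: wf_ctx_typing_equal.inducts) (auto elim: wf_ctx_consE)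

text \<open>The newest variable is neutral with normal form \<open>NVar 0\<close>, so reflection
  relates it to itself. Its type is semantically reflexive by the fundamental theorem in the shorter
  context, followed by weakening.\<close>

lemma sub_eq_Var: "\<turnstile> \<Gamma> \<Longrightarrow> sub_eq {\<Gamma>} \<Gamma> Var Var"
proof (induction \<Gamma>)
  case (Cons b \<Gamma>)
  obtain a U where b: "b = (a, U)" by (cases b)
  obtain s where s: "\<turnstile> \<Gamma>" "\<Gamma> \<turnstile> U \<Colon> Srt s"
    using Cons.prems unfolding b by (rule wf_ctx_consE)
  note IH = Cons.IH[OF s(1)]
  let ?w = "{(a, U) # \<Gamma>}"
  have e: "ext Suc ?w {\<Gamma>}" by (simp add: ext_def tren_Suc)
  have "teq {\<Gamma>} (sub Var U) (sub Var U)"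
    by (rule valid_teq[OF fundamental(2)[OF s(2)] _ IH]) simp
  then have U: "teq ?w (weak U) (weak U)" using teq_ren[OF _ e] by simp
  have "tmeq ?w (weak U) (weak U) (Var 0) (Var 0)" if "a = Rel"
  proof -
    obtain n where n: "LR n ?w (weak U) (weak U) (tmeq ?w (weak U) (weak U))"
      using U by (rule teqE)
    have "nenf ((a, U) # \<Gamma>) (Var 0) (NVar 0) (weak U)"
      using that by (simp add: nenf_var lookup_0)
    then have "wnety ?w (Var 0) (NVar 0) (weak U)"
      using U by (auto simp: wnety_def)
    then show ?thesis using LR_reify_reflect[OF n] by blast
  qed
  moreover have "sub (\<lambda>x. Var (Suc x)) U = weak U"
    using ren_sub[of Suc Var U] by simp
  ultimately show ?case
    using sub_eq_ren[OF IH e] unfolding b by simp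
qed simp

theorem theorem6p4:
  fixes \<Gamma> :: ctx and t t' T :: expr
  assumes "\<Gamma> \<turnstile> t \<doteq> t' \<Colon> T"
  shows "\<Gamma> \<turnstile> t \<Longleftrightarrow>\<^sub>t\<^sub>m t' \<Colon> T"
proof -
  have "tmeq {\<Gamma>} (sub Var T) (sub Var T) (sub Var t) (sub Var t')"
    by (rule validD[OF fundamental(3)[OF assms] _ sub_eq_Var[OF typing_wf_ctx(3)[OF assms]]]) simp
  then have *: "tmeq {\<Gamma>} T T t t'" by simp
  obtain n where n: "LR n {\<Gamma>} T T (tmeq {\<Gamma>} T T)"
    using tmeq_teq[OF *] by (rule teqE)
  obtain v where "wtmnf {\<Gamma>} t T v" "wtmnf {\<Gamma>} t' T v"
    using LR_reify_reflect[OF n] * by blast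
  \<comment> \<open>\<open>wtmnf\<close> is taken at the representative \<open>T\<close>
    itself.\<close>
  then have "tmnf \<Gamma> t T v" "tmnf \<Gamma> t' T v"
    using tmeq_teq[OF *] unfolding wtmnf_def by blast+
  then show ?thesis by (rule nf_alg(3))
qed

end
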